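(* There is a constant $C>0$ such that for every smooth helical vector field $u$ on $\mathbb{R}^2\times\mathbb{T}$ and every $x=(x_1,x_2,x_3)\in\mathbb{R}^2\times\mathbb{T}$, $$\|u\|_{L^4(C(x,1))}^4\le C\Big(\|u\|_{L^2(C(x,2))}^2\|\nabla u\|_{L^2(C(x,2))}^2+\|u\|_{L^2(C(x,2))}^4\Big).$$
   Context: $\mathbb{T}=\mathbb{R}/2\pi\mathbb{Z}$; functions on $\mathbb{R}^2\times\mathbb{T}$ are identified with functions on $\mathbb{R}^3$ that are $2\pi$-periodic in $x_3$. $C(x,l)=\{y\in\mathbb{R}^2\times\mathbb{T}:|(x_1,x_2)-(y_1,y_2)|<l\}$ is the cylinder with axis through $x$ (not necessarily centered at the origin). Helical symmetry: $R_\theta=\begin{pmatrix}\cos\theta&\sin\theta&0\\-\sin\theta&\cos\theta&0\\0&0&1\end{pmatrix}$, $S_\theta(x)=R_\theta x+(0,0,\theta)^t$. A vector field $v$ is helical if $R_\theta(v(x))=v(S_\theta x)$ for all $x$ and all $\theta\in\mathbb{R}$. *)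

theory Defs
  imports "HOL-Analysis.Analysis"
begin

text \<open>
  Functions on \<open>\<real>\<^sup>2 \<times> \<real>/2\<pi>\<int>\<close> are represented by functions on \<open>real^3\<close> with period
  \<open>2 * pi\<close> in the third variable, and subsets by sets invariant under the same translation.
\<close>

definition x3_periodic :: "(real^3 \<Rightarrow> 'a) \<Rightarrow> bool" where
  "x3_periodic f \<longleftrightarrow> (\<forall>x. f (x + axis 3 (2 * pi)) = f x)"

primrec k_times_cont_differentiable ::
    "nat \<Rightarrow> ('a::real_normed_vector \<Rightarrow> 'b::real_normed_vector) \<Rightarrow> bool" where
  "k_times_cont_differentiable 0 f \<longleftrightarrow> continuous_on UNIV f"
| "k_times_cont_differentiable (Suc k) f \<longleftrightarrow>
     (\<forall>x. f differentiable (at x)) \<and>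
     (\<forall>v. k_times_cont_differentiable k (\<lambda>x. frechet_derivative f (at x) v))"

definition smooth :: "('a::real_normed_vector \<Rightarrow> 'b::real_normed_vector) \<Rightarrow> bool" where
  "smooth f \<longleftrightarrow> (\<forall>k. k_times_cont_differentiable k f)"

definition rot :: "real \<Rightarrow> real^3^3" where
  "rot \<theta> = vector [vector [cos \<theta>, sin \<theta>, 0],
                    vector [- sin \<theta>, cos \<theta>, 0],
                    vector [0, 0, 1]]"

definition screw :: "real \<Rightarrow> real^3 \<Rightarrow> real^3" where
  "screw \<theta> x = rot \<theta> *v x + vector [0, 0, \<theta>]"

definition helical :: "(real^3 \<Rightarrow> real^3) \<Rightarrow> bool" where
  "helical v \<longleftrightarrow> (\<forall>x \<theta>. rot \<theta> *v v x = v (screw \<theta> x))"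

definition cylinder :: "real^3 \<Rightarrow> real \<Rightarrow> (real^3) set" where
  "cylinder x l = {y. sqrt ((x$1 - y$1)\<^sup>2 + (x$2 - y$2)\<^sup>2) < l}"

text \<open>
  Integration over the quotient is integration over the fundamental domain
  \<open>0 \<le> y$3 < 2 * pi\<close>. The integral is a Bochner integral, so it is the \<open>L\<^sup>p\<close> norm only
  when \<open>norm (f y) powr p\<close> is integrable; this holds for continuous periodic \<open>f\<close> on
  the cylinders, which are relatively compact in the quotient.
\<close>

definition Lp_norm :: "real \<Rightarrow> (real^3) set \<Rightarrow> (real^3 \<Rightarrow> 'b::real_normed_vector) \<Rightarrow> real" where
  "Lp_norm p D f =
     (LINT y : D \<inter> {y. 0 \<le> y$3 \<and> y$3 < 2 * pi} | lborel. norm (f y) powr p) powr (1 / p)"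

text \<open>
  The \<open>norm\<close> of the type \<open>real^3^3\<close> is the Frobenius norm, so \<open>norm (grad u x)\<close> is the
  Euclidean norm of the tuple of all first-order partial derivatives of \<open>u\<close>.
\<close>

definition grad :: "(real^3 \<Rightarrow> real^3) \<Rightarrow> real^3 \<Rightarrow> real^3^3" where
  "grad u x = jacobian u (at x)"

end

theory Submission
  imports Defs
begin

text \<open>
  Put \<open>g = \<bar>u\<bar>\<^sup>2\<close> and \<open>k = \<bar>u\<bar>\<^sup>2 + 2 \<bar>u\<bar> \<bar>\<nabla>u\<bar>\<close>. Both are invariant under the screw motions, and
  on a segment of length at least 1 parallel to a coordinate axis \<open>g\<close> is bounded by the integral of
  \<open>k\<close> over the segment. By Cauchy-Schwarz it suffices to bound the integral of \<open>g\<^sup>2\<close> over the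
  cylinder of radius 1 by the square of \<open>M\<close>, the integral of \<open>k\<close> over the cylinder of radius 2.

  By helical invariance the integral of \<open>g\<close> over a vertical period is a radial function \<open>H\<close> of the
  first two coordinates. At distance at least \<open>1/4\<close> from the axis of symmetry the one-dimensional
  bound, averaged over parallel lines meeting the same circle, gives \<open>H \<le> 8 M\<close>, while vertically
  \<open>g\<close> is at most the integral of \<open>k\<close> over a period; the product of the two bounds is integrated over
  the disc. Near the axis the two horizontal bounds give the Ladyzhenskaya inequality in each
  horizontal slice, and the slice integrals of \<open>k\<close> over a disc centred on the axis do not depend on
  the height, so they are at most \<open>M / (2 \<pi>)\<close>.
\<close>

section \<open>Integration over lines, planes and space\<close>

text \<open>Compare \<open>\<phi> p\<close> with the minimum of \<open>\<phi>\<close> on the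
  interval. As the length is at least 1, the minimum is at most the integral of
  \<open>\<phi>\<close>; the increment from the minimum point to \<open>p\<close> is an integral of
  \<open>\<phi>'\<close>, hence at most the integral of \<open>\<psi>\<close>.\<close>

lemma agmon_interval:
  fixes \<phi> \<phi>' \<psi> :: "real \<Rightarrow> real"
  assumes deriv: "\<And>s. (\<phi> has_real_derivative \<phi>' s) (at s)"
    and cont: "continuous_on UNIV \<phi>'" "continuous_on UNIV \<psi>"
    and nonneg: "\<And>s. 0 \<le> \<phi> s" and bound: "\<And>s. \<bar>\<phi>' s\<bar> \<le> \<psi> s"
    and p: "p \<in> {\<alpha>..\<beta>}" and len: "1 \<le> \<beta> - \<alpha>"
  shows "ennreal (\<phi> p) \<le> (\<integral>\<^sup>+s\<in>{\<alpha>..\<beta>}. ennreal (\<phi> s + \<psi> s) \<partial>lborel)"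
proof -
  have \<psi>_nonneg: "0 \<le> \<psi> s" for s
    using bound[of s] by linarith
  have cont_\<phi>: "continuous_on UNIV \<phi>"
    using deriv by (auto intro!: continuous_at_imp_continuous_on DERIV_isCont)
  have contI: "continuous_on {a..b} \<phi>" "continuous_on {a..b} \<psi>" "continuous_on {a..b} \<phi>'" for a b
    using cont cont_\<phi> continuous_on_subset by blast+
  obtain q where q: "q \<in> {\<alpha>..\<beta>}" "\<And>s. s \<in> {\<alpha>..\<beta>} \<Longrightarrow> \<phi> q \<le> \<phi> s"
    using continuous_attains_inf[of "{\<alpha>..\<beta>}" \<phi>] contI(1) p by auto
  have diff: "\<bar>\<phi> b - \<phi> a\<bar> \<le> integral {\<alpha>..\<beta>} \<psi>" if "a \<le> b" "\<alpha> \<le> a" "b \<le> \<beta>" for a b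
  proof -
    have I: "(\<phi>' has_integral (\<phi> b - \<phi> a)) {a..b}"
      using deriv that(1)
      by (intro fundamental_theorem_of_calculus)
         (auto simp: has_real_derivative_iff_has_vector_derivative[symmetric]
               intro: has_field_derivative_at_within)
    have "norm (integral {a..b} \<phi>') \<le> integral {a..b} \<psi>"
      using bound contI by (intro integral_norm_bound_integral integrable_continuous_real) auto
    also have "\<dots> \<le> integral {\<alpha>..\<beta>} \<psi>"
      using that contI \<psi>_nonneg by (intro integral_subset_le integrable_continuous_real) auto
    finally show ?thesis
      using I by (simp add: integral_unique)
  qed
  have "\<phi> p - \<phi> q \<le> integral {\<alpha>..\<beta>} \<psi>"
    using diff[of p q] diff[of q p] p q(1) by (cases "p \<le> q") auto
  moreover have "\<phi> q \<le> integral {\<alpha>..\<beta>} \<phi>"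
  proof -
    have "1 * \<phi> q \<le> (\<beta> - \<alpha>) * \<phi> q"
      using len nonneg by (intro mult_right_mono) auto
    also have "\<dots> = integral {\<alpha>..\<beta>} (\<lambda>_. \<phi> q)"
      using len by simp
    also have "\<dots> \<le> integral {\<alpha>..\<beta>} \<phi>"
      using q(2) contI by (intro integral_le integrable_continuous_real) auto
    finally show ?thesis by simp
  qed
  moreover have "integral {\<alpha>..\<beta>} (\<lambda>s. \<phi> s + \<psi> s) = integral {\<alpha>..\<beta>} \<phi> + integral {\<alpha>..\<beta>} \<psi>"
    using contI by (intro integral_add integrable_continuous_real)
  ultimately have le: "\<phi> p \<le> integral {\<alpha>..\<beta>} (\<lambda>s. \<phi> s + \<psi> s)"
    by linarith
  have [measurable]: "\<phi> \<in> borel_measurable borel" "\<psi> \<in> borel_measurable borel"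
    using cont_\<phi> cont borel_measurable_continuous_onI by blast+
  \<comment> \<open>Passage from the Henstock-Kurzweil to the Lebesgue integral, done for the
    nonnegative integrand cut off to the interval.\<close>
  have "((\<lambda>s. \<phi> s + \<psi> s) has_integral integral {\<alpha>..\<beta>} (\<lambda>s. \<phi> s + \<psi> s)) {\<alpha>..\<beta>}"
    using contI by (intro integrable_integral integrable_continuous_real continuous_intros)
  then have "((\<lambda>s. if s \<in> {\<alpha>..\<beta>} then \<phi> s + \<psi> s else 0) has_integral
      integral {\<alpha>..\<beta>} (\<lambda>s. \<phi> s + \<psi> s)) UNIV"
    by (simp only: has_integral_restrict_UNIV)
  from nn_integral_has_integral_lborel[OF _ _ this]
  have "(\<integral>\<^sup>+s. ennreal (if s \<in> {\<alpha>..\<beta>} then \<phi> s + \<psi> s else 0) \<partial>lborel)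
      = ennreal (integral {\<alpha>..\<beta>} (\<lambda>s. \<phi> s + \<psi> s))"
    using nonneg \<psi>_nonneg by simp
  moreover have "(\<integral>\<^sup>+s. ennreal (if s \<in> {\<alpha>..\<beta>} then \<phi> s + \<psi> s else 0) \<partial>lborel) =
      (\<integral>\<^sup>+s\<in>{\<alpha>..\<beta>}. ennreal (\<phi> s + \<psi> s) \<partial>lborel)"
    by (intro nn_integral_cong) (auto simp: indicator_def)
  ultimately show ?thesis
    using ennreal_leI[OF le] by (simp only:)
qed

section \<open>Translations, shears and rotations of Lebesgue integrals\<close>

lemma nn_integral_translate:
  fixes f :: "real \<Rightarrow> ennreal"
  assumes "f \<in> borel_measurable borel"
  shows "(\<integral>\<^sup>+x. f (x + t) \<partial>lborel) = (\<integral>\<^sup>+x. f x \<partial>lborel)"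
  using nn_integral_real_affine[OF assms, of 1 t] by (simp add: add.commute)

text \<open>For fixed \<open>b\<close> the shear is a translation in \<open>a\<close>, once Tonelli
  has moved the integral over \<open>a\<close> inside.\<close>

lemma nn_integral_shear_fst:
  fixes G :: "real \<times> real \<Rightarrow> ennreal"
  assumes [measurable]: "G \<in> borel_measurable (borel \<Otimes>\<^sub>M borel)"
  shows "(\<integral>\<^sup>+a. \<integral>\<^sup>+b. G (a + \<tau> * b, b) \<partial>lborel \<partial>lborel) = (\<integral>\<^sup>+a. \<integral>\<^sup>+b. G (a, b) \<partial>lborel \<partial>lborel)"
proof -
  have "(\<integral>\<^sup>+a. \<integral>\<^sup>+b. G (a + \<tau> * b, b) \<partial>lborel \<partial>lborel) =
      (\<integral>\<^sup>+b. \<integral>\<^sup>+a. G (a + \<tau> * b, b) \<partial>lborel \<partial>lborel)"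
    by (intro lborel_pair.Fubini'[symmetric]) measurable
  also have "\<dots> = (\<integral>\<^sup>+b. \<integral>\<^sup>+a. G (a, b) \<partial>lborel \<partial>lborel)"
    by (intro nn_integral_cong nn_integral_translate[of "\<lambda>a. G (a, _)"]) measurable
  also have "\<dots> = (\<integral>\<^sup>+a. \<integral>\<^sup>+b. G (a, b) \<partial>lborel \<partial>lborel)"
    by (intro lborel_pair.Fubini') measurable
  finally show ?thesis .
qed

lemma nn_integral_shear_snd:
  fixes G :: "real \<times> real \<Rightarrow> ennreal"
  assumes [measurable]: "G \<in> borel_measurable (borel \<Otimes>\<^sub>M borel)"
  shows "(\<integral>\<^sup>+a. \<integral>\<^sup>+b. G (a, b + \<tau> * a) \<partial>lborel \<partial>lborel) = (\<integral>\<^sup>+a. \<integral>\<^sup>+b. G (a, b) \<partial>lborel \<partial>lborel)"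
  by (intro nn_integral_cong nn_integral_translate[of "\<lambda>b. G (_, b)"]) measurable

text \<open>A rotation by an angle other than \<open>\<pi>\<close> is a product of three shears; the angle \<open>\<pi>\<close>
  is two quarter turns.\<close>

lemma nn_integral_rotate:
  fixes G :: "real \<times> real \<Rightarrow> ennreal"
  assumes [measurable]: "G \<in> borel_measurable (borel \<Otimes>\<^sub>M borel)" and cs: "c\<^sup>2 + s\<^sup>2 = 1"
  shows "(\<integral>\<^sup>+a. \<integral>\<^sup>+b. G (c * a + s * b, c * b - s * a) \<partial>lborel \<partial>lborel) =
    (\<integral>\<^sup>+a. \<integral>\<^sup>+b. G (a, b) \<partial>lborel \<partial>lborel)"
proof -
  have rot: "(\<integral>\<^sup>+a. \<integral>\<^sup>+b. G (c * a + s * b, c * b - s * a) \<partial>lborel \<partial>lborel) =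
      (\<integral>\<^sup>+a. \<integral>\<^sup>+b. G (a, b) \<partial>lborel \<partial>lborel)"
    if [measurable]: "G \<in> borel_measurable (borel \<Otimes>\<^sub>M borel)" and cs: "c\<^sup>2 + s\<^sup>2 = 1" "c \<noteq> -1"
    for G :: "real \<times> real \<Rightarrow> ennreal" and c s :: real
  proof -
    \<comment> \<open>\<open>\<tau>\<close> is the tangent of half the rotation angle; the
      identities \<open>\<tau> * s = 1 - c\<close> and \<open>\<tau> * (1 + c) = s\<close> turn the
      composed shears into the rotation.\<close>
    define \<tau> where "\<tau> = s / (1 + c)"
    have "1 + c \<noteq> 0"
      using cs(2) by linarith
    have "s * s = (1 - c) * (1 + c)"
      using cs(1) by (simp add: power2_eq_square algebra_simps)
    then have \<tau>s: "\<tau> * s = 1 - c" and \<tau>c: "\<tau> * (1 + c) = s"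
      using \<open>1 + c \<noteq> 0\<close> by (simp_all add: \<tau>_def)
    have "(\<integral>\<^sup>+a. \<integral>\<^sup>+b. G (a, b) \<partial>lborel \<partial>lborel) =
        (\<integral>\<^sup>+a. \<integral>\<^sup>+b. G (a + \<tau> * b, b) \<partial>lborel \<partial>lborel)"
      by (rule nn_integral_shear_fst[symmetric]) measurable
    also have "\<dots> = (\<integral>\<^sup>+a. \<integral>\<^sup>+b. (\<lambda>(a, b). G (a + \<tau> * b, b)) (a, b) \<partial>lborel \<partial>lborel)"
      by simp
    also have "\<dots> = (\<integral>\<^sup>+a. \<integral>\<^sup>+b. (\<lambda>(a, b). G (a + \<tau> * b, b)) (a, b + (- s) * a) \<partial>lborel \<partial>lborel)"
      by (rule nn_integral_shear_snd[symmetric]) measurable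
    also have "\<dots> = (\<integral>\<^sup>+a. \<integral>\<^sup>+b. (\<lambda>(a, b). (\<lambda>(a, b). G (a + \<tau> * b, b)) (a, b + (- s) * a)) (a, b)
        \<partial>lborel \<partial>lborel)"
      by simp
    also have "\<dots> = (\<integral>\<^sup>+a. \<integral>\<^sup>+b. (\<lambda>(a, b). (\<lambda>(a, b). G (a + \<tau> * b, b)) (a, b + (- s) * a)) (a + \<tau> * b, b)
        \<partial>lborel \<partial>lborel)"
      by (rule nn_integral_shear_fst[symmetric]) measurable
    also have "\<dots> = (\<integral>\<^sup>+a. \<integral>\<^sup>+b. G (c * a + s * b, c * b - s * a) \<partial>lborel \<partial>lborel)"
    proof (intro nn_integral_cong)
      fix a b :: real
      have 1: "b + - s * (a + \<tau> * b) = (1 - \<tau> * s) * b - s * a"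
        by (simp add: algebra_simps)
      have 2: "a + \<tau> * b + \<tau> * (c * b - s * a)
          = (1 - \<tau> * s) * a + \<tau> * (1 + c) * b"
        by (simp add: algebra_simps)
      show "(\<lambda>(a, b). (\<lambda>(a, b). G (a + \<tau> * b, b)) (a, b + (- s) * a)) (a + \<tau> * b, b) =
          G (c * a + s * b, c * b - s * a)"
        unfolding prod.case 1 unfolding \<tau>s by (simp add: 2 \<tau>s \<tau>c)
    qed
    finally show ?thesis by simp
  qed
  show ?thesis
  proof (cases "c = -1")
    case True
    then have [simp]: "s = 0"
      using cs by simp
    have quarter: "(\<integral>\<^sup>+a. \<integral>\<^sup>+b. F (b, - a) \<partial>lborel \<partial>lborel) = (\<integral>\<^sup>+a. \<integral>\<^sup>+b. F (a, b) \<partial>lborel \<partial>lborel)"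
      if "F \<in> borel_measurable (borel \<Otimes>\<^sub>M borel)" for F :: "real \<times> real \<Rightarrow> ennreal"
      using rot[OF that, of 0 1] by simp
    have "(\<integral>\<^sup>+a. \<integral>\<^sup>+b. (\<lambda>(a, b). G (b, - a)) (b, - a) \<partial>lborel \<partial>lborel) =
        (\<integral>\<^sup>+a. \<integral>\<^sup>+b. (\<lambda>(a, b). G (b, - a)) (a, b) \<partial>lborel \<partial>lborel)"
      by (rule quarter) measurable
    with quarter[OF assms(1)] True show ?thesis
      by simp
  qed (use rot[OF assms] in auto)
qed

text \<open>The part of the shifted window that sticks out beyond \<open>P\<close> is moved back by
  one period and fills the gap left at the start.\<close>

lemma nn_integral_periodic_shift:
  fixes h :: "real \<Rightarrow> ennreal"
  assumes [measurable]: "h \<in> borel_measurable borel" and per: "\<And>t. h (t + P) = h t"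
    and \<phi>: "0 \<le> \<phi>" "\<phi> < P"
  shows "(\<integral>\<^sup>+t\<in>{0..<P}. h (t + \<phi>) \<partial>lborel) = (\<integral>\<^sup>+t\<in>{0..<P}. h t \<partial>lborel)"
proof -
  have "(\<integral>\<^sup>+t\<in>{0..<P}. h (t + \<phi>) \<partial>lborel) = (\<integral>\<^sup>+t. h (t + \<phi>) * indicator {\<phi>..<P+\<phi>} (t + \<phi>) \<partial>lborel)"
    by (intro nn_integral_cong) (auto simp: indicator_def)
  also have "\<dots> = (\<integral>\<^sup>+t. h t * indicator {\<phi>..<P+\<phi>} t \<partial>lborel)"
    by (intro nn_integral_translate[of "\<lambda>t. h t * indicator {\<phi>..<P+\<phi>} t"]) measurable
  also have "\<dots> = (\<integral>\<^sup>+t. h t * indicator {\<phi>..<P} t + h t * indicator {P..<P+\<phi>} t \<partial>lborel)"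
    using \<phi> by (intro nn_integral_cong) (auto simp: indicator_def)
  also have "\<dots> = (\<integral>\<^sup>+t. h t * indicator {\<phi>..<P} t \<partial>lborel) + (\<integral>\<^sup>+t. h t * indicator {P..<P+\<phi>} t \<partial>lborel)"
    by (intro nn_integral_add) measurable
  also have "(\<integral>\<^sup>+t. h t * indicator {P..<P+\<phi>} t \<partial>lborel)
      = (\<integral>\<^sup>+t. h (t + P) * indicator {P..<P+\<phi>} (t + P) \<partial>lborel)"
    by (intro nn_integral_translate[of "\<lambda>t. h t * indicator {P..<P+\<phi>} t", symmetric]) measurable
  also have "\<dots> = (\<integral>\<^sup>+t. h t * indicator {0..<\<phi>} t \<partial>lborel)"
    by (intro nn_integral_cong) (auto simp: indicator_def per)
  also have "(\<integral>\<^sup>+t. h t * indicator {\<phi>..<P} t \<partial>lborel) + (\<integral>\<^sup>+t. h t * indicator {0..<\<phi>} t \<partial>lborel)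
      = (\<integral>\<^sup>+t. h t * indicator {\<phi>..<P} t + h t * indicator {0..<\<phi>} t \<partial>lborel)"
    by (intro nn_integral_add[symmetric]) measurable
  also have "\<dots> = (\<integral>\<^sup>+t. h t * indicator {0..<P} t \<partial>lborel)"
    using \<phi> by (intro nn_integral_cong) (auto simp: indicator_def)
  finally show ?thesis .
qed

section \<open>Iterated integrals on three-space\<close>

lemma continuous_on_vector3:
  fixes f g h :: "'a::topological_space \<Rightarrow> real"
  assumes "continuous_on S f" "continuous_on S g" "continuous_on S h"
  shows "continuous_on S (\<lambda>p. vector [f p, g p, h p] :: real^3)"
proof -
  have "continuous_on S (\<lambda>p. \<chi> i. (vector [f p, g p, h p] :: real^3) $ i)"
  proof (rule continuous_on_vec_lambda)
    fix i :: 3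
    show "continuous_on S (\<lambda>p. (vector [f p, g p, h p] :: real^3) $ i)"
      using exhaust_3[of i] assms by auto
  qed
  then show ?thesis
    by (simp only: vec_nth_inverse)
qed

lemma nn_integral_real3:
  fixes F :: "real^3 \<Rightarrow> ennreal"
  assumes [measurable]: "F \<in> borel_measurable borel"
  shows "(\<integral>\<^sup>+y. F y \<partial>lborel) = (\<integral>\<^sup>+a. \<integral>\<^sup>+b. \<integral>\<^sup>+t. F (vector [a, b, t]) \<partial>lborel \<partial>lborel \<partial>lborel)"
proof -
  let ?v = "\<lambda>p :: real \<times> real \<times> real. vector [fst p, fst (snd p), snd (snd p)] :: real^3"
  have "?v \<in> borel_measurable borel"
    by (intro borel_measurable_continuous_onI continuous_on_vector3 continuous_intros)
  then have v[measurable]: "?v \<in> borel_measurable (borel \<Otimes>\<^sub>M borel \<Otimes>\<^sub>M borel)"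
    by (simp only: borel_prod)
  have v'[measurable]: "?v \<in> borel_measurable lborel"
    using v by (simp only: borel_prod measurable_lborel2)
  \<comment> \<open>Lebesgue measure is determined by the volumes of boxes, and the coordinate map
    pulls boxes back to boxes with the same side lengths. Tonelli then gives the iterated
    integral.\<close>
  have "lborel = distr lborel borel ?v"
  proof (rule lborel_eqI)
    fix l u :: "real^3"
    assume le: "\<And>b. b \<in> Basis \<Longrightarrow> l \<bullet> b \<le> u \<bullet> b"
    have le': "l $ i \<le> u $ i" for i
      using le[of "axis i 1"] by (simp add: inner_axis axis_in_Basis_iff)
    have vim: "?v -` box l u = box (l$1, l$2, l$3) (u$1, u$2, u$3)"
      by (auto simp: mem_box_cart forall_3 mem_box Basis_prod_def)
    have "emeasure (distr lborel borel ?v) (box l u) = emeasure lborel (?v -` box l u)"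
      by (subst emeasure_distr) simp_all
    also have "\<dots> = ennreal ((u$1 - l$1) * ((u$2 - l$2) * (u$3 - l$3)))"
      unfolding vim using le'
      by (subst emeasure_lborel_box) (auto simp: Basis_prod_def prod.union_disjoint prod.reindex inj_on_def)
    also have "\<dots> = ennreal (\<Prod>i\<in>UNIV. (u - l) $ i)"
      unfolding UNIV_3 by (simp add: mult.assoc)
    also have "(\<Prod>i\<in>UNIV. (u - l) $ i) = (\<Prod>b\<in>Basis. (u - l) \<bullet> b)"
    proof -
      have B: "(Basis :: (real^3) set) = range (\<lambda>i. axis i 1)"
        by (auto simp: Basis_vec_def)
      show ?thesis
        unfolding B by (subst prod.reindex) (auto simp: inj_on_def axis_eq_axis inner_axis)
    qed
    finally show "emeasure (distr lborel borel ?v) (box l u) = ennreal (\<Prod>b\<in>Basis. (u - l) \<bullet> b)" .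
  qed simp
  then have "(\<integral>\<^sup>+y. F y \<partial>lborel) = (\<integral>\<^sup>+y. F y \<partial>distr lborel borel ?v)"
    by (rule arg_cong[where f="\<lambda>M. nn_integral M F"])
  also have "\<dots> = (\<integral>\<^sup>+p. F (?v p) \<partial>lborel)"
    by (rule nn_integral_distr) measurable
  also have "\<dots> = (\<integral>\<^sup>+p. F (?v p) \<partial>(lborel \<Otimes>\<^sub>M lborel))"
    by (simp only: lborel_prod)
  also have "\<dots> = (\<integral>\<^sup>+a. \<integral>\<^sup>+q. F (?v (a, q)) \<partial>lborel \<partial>lborel)"
  proof (rule lborel.nn_integral_fst[symmetric])
    show "(\<lambda>p. F (?v p)) \<in> borel_measurable (lborel \<Otimes>\<^sub>M lborel)"
      using measurable_compose[OF v' assms] by (simp only: lborel_prod)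
  qed
  also have "\<dots> = (\<integral>\<^sup>+a. \<integral>\<^sup>+q. F (?v (a, q)) \<partial>(lborel \<Otimes>\<^sub>M lborel) \<partial>lborel)"
    by (simp only: lborel_prod)
  also have "\<dots> = (\<integral>\<^sup>+a. \<integral>\<^sup>+b. \<integral>\<^sup>+t. F (?v (a, b, t)) \<partial>lborel \<partial>lborel \<partial>lborel)"
  proof (intro nn_integral_cong lborel.nn_integral_fst[symmetric])
    fix a :: real
    have "(\<lambda>q. F (?v (a, q))) \<in> borel_measurable borel"
      by (intro measurable_compose[OF _ assms] borel_measurable_continuous_onI continuous_on_vector3)
         (auto intro!: continuous_intros)
    then show "(\<lambda>q. F (?v (a, q))) \<in> borel_measurable (lborel \<Otimes>\<^sub>M lborel)"
      by (simp only: lborel_prod measurable_lborel2)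
  qed
  finally show ?thesis
    by (simp only: fst_conv snd_conv)
qed

section \<open>Helically invariant densities\<close>

lemma nn_integral_rotate_coords:
  fixes f :: "real \<times> real \<times> real \<Rightarrow> ennreal"
  assumes [measurable]: "f \<in> borel_measurable (borel \<Otimes>\<^sub>M borel \<Otimes>\<^sub>M borel)"
  shows "(\<integral>\<^sup>+a. \<integral>\<^sup>+b. \<integral>\<^sup>+t. f (a, b, t) \<partial>lborel \<partial>lborel \<partial>lborel) =
    (\<integral>\<^sup>+t. \<integral>\<^sup>+a. \<integral>\<^sup>+b. f (a, b, t) \<partial>lborel \<partial>lborel \<partial>lborel)"
proof -
  have "(\<integral>\<^sup>+a. \<integral>\<^sup>+b. \<integral>\<^sup>+t. f (a, b, t) \<partial>lborel \<partial>lborel \<partial>lborel) =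
      (\<integral>\<^sup>+a. \<integral>\<^sup>+t. \<integral>\<^sup>+b. f (a, b, t) \<partial>lborel \<partial>lborel \<partial>lborel)"
    by (intro nn_integral_cong lborel_pair.Fubini') measurable
  also have "\<dots> = (\<integral>\<^sup>+t. \<integral>\<^sup>+a. \<integral>\<^sup>+b. f (a, b, t) \<partial>lborel \<partial>lborel \<partial>lborel)"
    by (intro lborel_pair.Fubini') measurable
  finally show ?thesis .
qed

text \<open>For a helically invariant density this is also the angular integral of the slice at
  height 0 over the circle through \<open>(a, b)\<close>.\<close>

definition orbit_mass :: "(real \<times> real \<times> real \<Rightarrow> ennreal) \<Rightarrow> real \<Rightarrow> real \<Rightarrow> ennreal" where
  "orbit_mass k a b = (\<integral>\<^sup>+t\<in>{0..<2*pi}. k (a, b, t) \<partial>lborel)"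

text \<open>The integral over one period of the cylinder of radius \<open>l\<close> about
  \<open>(p, q)\<close>, for positive \<open>l\<close>. The cutoff acts on the squared distance, so
  its rotation invariance is a polynomial identity.\<close>

definition disc_mass :: "(real \<times> real \<times> real \<Rightarrow> ennreal) \<Rightarrow> real \<Rightarrow> real \<Rightarrow> real \<Rightarrow> ennreal" where
  "disc_mass k p q l =
    (\<integral>\<^sup>+a. \<integral>\<^sup>+b. orbit_mass k a b * indicator {z. z < l\<^sup>2} ((p - a)\<^sup>2 + (q - b)\<^sup>2) \<partial>lborel \<partial>lborel)"

text \<open>Scalar form of helical symmetry: a helical vector turns with the screw motion, but its
  length does not change. Values in \<open>ennreal\<close> let Tonelli apply without integrability
  conditions.\<close>

locale helical_density =
  fixes k :: "real \<times> real \<times> real \<Rightarrow> ennreal"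
  assumes measurable_density [measurable]: "k \<in> borel_measurable (borel \<Otimes>\<^sub>M borel \<Otimes>\<^sub>M borel)"
    and invariant: "k (cos \<theta> * a + sin \<theta> * b, cos \<theta> * b - sin \<theta> * a, t + \<theta>) = k (a, b, t)"
begin

lemma measurable_orbit_mass [measurable]:
  "(\<lambda>(a, b). orbit_mass k a b) \<in> borel_measurable (borel \<Otimes>\<^sub>M borel)"
  unfolding orbit_mass_def by measurable

text \<open>By invariance, rotating the point amounts to a vertical shift, which an integral over a
  full period absorbs.\<close>

lemma orbit_mass_rotate:
  assumes cs: "c\<^sup>2 + s\<^sup>2 = 1"
  shows "orbit_mass k (c * a + s * b) (c * b - s * a) = orbit_mass k a b"
proof -
  obtain \<theta> where \<theta>: "0 \<le> \<theta>" "\<theta> < 2 * pi" "c = cos \<theta>" "s = sin \<theta>"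
    using sincos_total_2pi[OF cs] by blast
  have per: "k (x, y, t + 2 * pi) = k (x, y, t)" for x y t
    using invariant[of "2 * pi" x y t] by simp
  have "orbit_mass k (c * a + s * b) (c * b - s * a) =
      (\<integral>\<^sup>+t\<in>{0..<2*pi}. k (c * a + s * b, c * b - s * a, t + \<theta>) \<partial>lborel)"
    unfolding orbit_mass_def
    by (rule nn_integral_periodic_shift[symmetric]) (use \<theta> per in \<open>simp_all\<close>)
  also have "\<dots> = orbit_mass k a b"
    by (simp add: orbit_mass_def \<theta> invariant)
  finally show ?thesis .
qed

lemma orbit_mass_radial:
  assumes "a\<^sup>2 + b\<^sup>2 = a'\<^sup>2 + b'\<^sup>2"
  shows "orbit_mass k a b = orbit_mass k a' b'"
proof -
  have "orbit_mass k a b = orbit_mass k (sqrt (a\<^sup>2 + b\<^sup>2)) 0" for a b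
  proof (cases "a\<^sup>2 + b\<^sup>2 = 0")
    case True
    then show ?thesis by (simp add: sum_power2_eq_zero_iff)
  next
    case False
    define \<rho> where "\<rho> = sqrt (a\<^sup>2 + b\<^sup>2)"
    have "\<rho> \<noteq> 0" and \<rho>2: "\<rho>\<^sup>2 = a\<^sup>2 + b\<^sup>2"
      using False by (simp_all add: \<rho>_def)
    \<comment> \<open>The rotations used here turn clockwise, so the sine that carries
      \<open>(\<rho>, 0)\<close> to \<open>(a, b)\<close> is \<open>- b / \<rho>\<close>.\<close>
    then have "(a / \<rho>)\<^sup>2 + (- b / \<rho>)\<^sup>2 = 1"
      using False by (simp add: power_divide flip: add_divide_distrib)
    from orbit_mass_rotate[OF this, of \<rho> 0] \<open>\<rho> \<noteq> 0\<close> show ?thesis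
      by (simp flip: \<rho>_def)
  qed
  then show ?thesis
    using assms by metis
qed

text \<open>A rotation of the integration variables preserves both the orbit mass and the distance
  to the centre. This permits placing the centre on the nonnegative first axis.\<close>

lemma disc_mass_rotate:
  assumes cs: "c\<^sup>2 + s\<^sup>2 = 1"
  shows "disc_mass k (c * p + s * q) (c * q - s * p) l = disc_mass k p q l"
proof -
  define G where "G = (\<lambda>(a, b). orbit_mass k a b * 
    indicator {z. z < l\<^sup>2} ((c * p + s * q - a)\<^sup>2 + (c * q - s * p - b)\<^sup>2))"
  have [measurable]: "G \<in> borel_measurable (borel \<Otimes>\<^sub>M borel)"
    unfolding G_def by measurable
  have "G (c * a + s * b, c * b - s * a) =
      orbit_mass k a b * indicator {z. z < l\<^sup>2} ((p - a)\<^sup>2 + (q - b)\<^sup>2)" for a b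
  proof -
    have "(c * p + s * q - (c * a + s * b))\<^sup>2 + (c * q - s * p - (c * b - s * a))\<^sup>2
        = (c\<^sup>2 + s\<^sup>2) * ((p - a)\<^sup>2 + (q - b)\<^sup>2)"
      by (simp add: power2_eq_square algebra_simps)
    then show ?thesis
      by (simp add: G_def orbit_mass_rotate[OF cs] cs)
  qed
  then have "disc_mass k p q l = (\<integral>\<^sup>+a. \<integral>\<^sup>+b. G (c * a + s * b, c * b - s * a) \<partial>lborel \<partial>lborel)"
    by (simp add: disc_mass_def)
  also have "\<dots> = (\<integral>\<^sup>+a. \<integral>\<^sup>+b. G (a, b) \<partial>lborel \<partial>lborel)"
    by (rule nn_integral_rotate[OF _ cs]) measurable
  also have "\<dots> = disc_mass k (c * p + s * q) (c * q - s * p) l"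
    by (simp add: disc_mass_def G_def)
  finally show ?thesis ..
qed

lemma disc_mass_radial: "disc_mass k p q l = disc_mass k (sqrt (p\<^sup>2 + q\<^sup>2)) 0 l"
proof (cases "p\<^sup>2 + q\<^sup>2 = 0")
  case True
  then show ?thesis by (simp add: sum_power2_eq_zero_iff)
next
  case False
  define \<rho> where "\<rho> = sqrt (p\<^sup>2 + q\<^sup>2)"
  have "\<rho> \<noteq> 0" and \<rho>2: "\<rho>\<^sup>2 = p\<^sup>2 + q\<^sup>2"
    using False by (simp_all add: \<rho>_def)
  then have "(p / \<rho>)\<^sup>2 + (- q / \<rho>)\<^sup>2 = 1"
    using False by (simp add: power_divide flip: add_divide_distrib)
  from disc_mass_rotate[OF this, of \<rho> 0] \<open>\<rho> \<noteq> 0\<close> show ?thesis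
    by (simp flip: \<rho>_def)
qed

section \<open>Slices and boxes contained in a cylinder\<close>

text \<open>Rotating the slice at height \<open>t\<close> by the angle \<open>t\<close> brings the
  density to height 0. The disc is centred on the axis of symmetry, so it is preserved.\<close>

lemma nn_integral_slice:
  "(\<integral>\<^sup>+a. \<integral>\<^sup>+b. k (a, b, t) * indicator {z. z < R} (a\<^sup>2 + b\<^sup>2) \<partial>lborel \<partial>lborel) =
   (\<integral>\<^sup>+a. \<integral>\<^sup>+b. k (a, b, 0) * indicator {z. z < R} (a\<^sup>2 + b\<^sup>2) \<partial>lborel \<partial>lborel)"
proof -
  define G where "G = (\<lambda>(a, b). k (a, b, t) * indicator {z. z < R} (a\<^sup>2 + b\<^sup>2))"
  have [measurable]: "G \<in> borel_measurable (borel \<Otimes>\<^sub>M borel)"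
    unfolding G_def by measurable
  have "G (cos t * a + sin t * b, cos t * b - sin t * a) =
      k (a, b, 0) * indicator {z. z < R} (a\<^sup>2 + b\<^sup>2)" for a b
  proof -
    have "(cos t * a + sin t * b)\<^sup>2 + (cos t * b - sin t * a)\<^sup>2
        = ((cos t)\<^sup>2 + (sin t)\<^sup>2) * (a\<^sup>2 + b\<^sup>2)"
      by (simp only: power2_eq_square) (simp only: algebra_simps)
    then show ?thesis
      using invariant[of t a b 0] by (simp add: G_def)
  qed
  moreover have "(\<integral>\<^sup>+a. \<integral>\<^sup>+b. G (cos t * a + sin t * b, cos t * b - sin t * a) \<partial>lborel \<partial>lborel) =
      (\<integral>\<^sup>+a. \<integral>\<^sup>+b. G (a, b) \<partial>lborel \<partial>lborel)"
    by (rule nn_integral_rotate) simp_all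
  ultimately show ?thesis
    by (simp add: G_def)
qed

text \<open>All slices of the centred cylinder of radius \<open>3/4\<close> have equal mass, so the
  left side is its mass over a period. It lies in the cylinder of radius 2 about
  \<open>(r, 0)\<close> because \<open>5/4 + 3/4 = 2\<close>.\<close>

lemma slice_le_disc_mass:
  assumes "0 \<le> r" "r < 5/4"
  shows "ennreal (2 * pi) * (\<integral>\<^sup>+a. \<integral>\<^sup>+b. k (a, b, 0) * indicator {z. z < 9/16} (a\<^sup>2 + b\<^sup>2) \<partial>lborel \<partial>lborel)
    \<le> disc_mass k r 0 2" (is "_ * ?m \<le> _")
proof -
  define f where "f = (\<lambda>(a, b, t). k (a, b, t) * indicator {z. z < 9/16} (a\<^sup>2 + b\<^sup>2) *
    indicator {0..<2*pi::real} t)"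
  have [measurable]: "f \<in> borel_measurable (borel \<Otimes>\<^sub>M borel \<Otimes>\<^sub>M borel)"
    unfolding f_def by measurable
  have "ennreal (2 * pi) * ?m = (\<integral>\<^sup>+t. ?m * indicator {0..<2*pi::real} t \<partial>lborel)"
    by (subst nn_integral_cmult_indicator) (simp_all add: mult.commute[of "ennreal (2 * pi)"])
  also have "\<dots> = (\<integral>\<^sup>+t. (\<integral>\<^sup>+a. \<integral>\<^sup>+b. k (a, b, t) * indicator {z. z < 9/16} (a\<^sup>2 + b\<^sup>2)
      \<partial>lborel \<partial>lborel) * indicator {0..<2*pi::real} t \<partial>lborel)"
    by (intro nn_integral_cong arg_cong2[where f = "(*)"] nn_integral_slice[symmetric] refl)
  also have "\<dots> = (\<integral>\<^sup>+t. \<integral>\<^sup>+a. \<integral>\<^sup>+b. f (a, b, t) \<partial>lborel \<partial>lborel \<partial>lborel)"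
    by (intro nn_integral_cong) (simp add: f_def nn_integral_multc)
  also have "\<dots> = (\<integral>\<^sup>+a. \<integral>\<^sup>+b. \<integral>\<^sup>+t. f (a, b, t) \<partial>lborel \<partial>lborel \<partial>lborel)"
    by (rule nn_integral_rotate_coords[symmetric]) measurable
  also have "\<dots> \<le> disc_mass k r 0 2"
    unfolding disc_mass_def
  proof (intro nn_integral_mono)
    fix a b :: real
    show "(\<integral>\<^sup>+t. f (a, b, t) \<partial>lborel) \<le>
      orbit_mass k a b * indicator {z. z < 2\<^sup>2} ((r - a)\<^sup>2 + (0 - b)\<^sup>2)"
    proof (cases "a\<^sup>2 + b\<^sup>2 < 9/16")
      case True
      have "a\<^sup>2 < (3/4)\<^sup>2"
        using True by (simp add: power_divide) (smt (verit) zero_le_power2)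
      then have "\<bar>a\<bar> < 3/4"
        by (metis abs_le_square_iff abs_of_pos linorder_not_le zero_less_divide_iff zero_less_numeral)
      then have "r * \<bar>a\<bar> \<le> 5/4 * (3/4)"
        using assms by (intro mult_mono') auto
      moreover have "r * (- a) \<le> r * \<bar>a\<bar>"
        using assms by (intro mult_left_mono) auto
      moreover have "r\<^sup>2 \<le> (5/4)\<^sup>2"
        using assms by (intro power_mono) auto
      ultimately have "(r - a)\<^sup>2 + (0 - b)\<^sup>2 < 2\<^sup>2"
        using True by (simp add: power2_eq_square algebra_simps)
      then show ?thesis
        using True by (simp add: f_def orbit_mass_def)
    qed (simp add: f_def)
  qed
  finally show ?thesis .
qed

text \<open>The rectangle fits in the disc of radius 2 since \<open>(3/2)^2 + (1/8)^2 < 4\<close>.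
  The range of \<open>b\<close> indexes the parallel lines over which the bound away from the axis
  is averaged.\<close>

lemma box_le_disc_mass:
  "(\<integral>\<^sup>+b\<in>{0..1/8}. (\<integral>\<^sup>+t\<in>{0..<2*pi}. (\<integral>\<^sup>+a\<in>{r-3/2..r+3/2}. k (a, b, t) \<partial>lborel) \<partial>lborel) \<partial>lborel)
    \<le> disc_mass k r 0 2"
proof -
  have "(\<integral>\<^sup>+b\<in>{0..1/8}. (\<integral>\<^sup>+t\<in>{0..<2*pi}. (\<integral>\<^sup>+a\<in>{r-3/2..r+3/2}. k (a, b, t) \<partial>lborel) \<partial>lborel) \<partial>lborel) =
     (\<integral>\<^sup>+b. \<integral>\<^sup>+t. \<integral>\<^sup>+a. k (a, b, t) * indicator {r-3/2..r+3/2} a * indicator {0..<2*pi} t * indicator {0..1/8} b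
       \<partial>lborel \<partial>lborel \<partial>lborel)"
    by (simp add: nn_integral_multc flip: mult.assoc)
  also have "\<dots> = (\<integral>\<^sup>+b. \<integral>\<^sup>+a. \<integral>\<^sup>+t. k (a, b, t) * indicator {r-3/2..r+3/2} a * indicator {0..<2*pi} t * indicator {0..1/8} b
       \<partial>lborel \<partial>lborel \<partial>lborel)"
    by (intro nn_integral_cong lborel_pair.Fubini') measurable
  also have "\<dots> = (\<integral>\<^sup>+a. \<integral>\<^sup>+b. \<integral>\<^sup>+t. k (a, b, t) * indicator {r-3/2..r+3/2} a * indicator {0..<2*pi} t * indicator {0..1/8} b
       \<partial>lborel \<partial>lborel \<partial>lborel)"
    by (intro lborel_pair.Fubini') measurable
  also have "\<dots> \<le> disc_mass k r 0 2"
    unfolding disc_mass_def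
  proof (intro nn_integral_mono)
    fix a b :: real
    show "(\<integral>\<^sup>+t. k (a, b, t) * indicator {r-3/2..r+3/2} a * indicator {0..<2*pi} t * indicator {0..1/8} b \<partial>lborel)
      \<le> orbit_mass k a b * indicator {z. z < 2\<^sup>2} ((r - a)\<^sup>2 + (0 - b)\<^sup>2)"
    proof (cases "a \<in> {r-3/2..r+3/2} \<and> b \<in> {0..1/8}")
      case True
      then have "\<bar>r - a\<bar> \<le> 3/2" "\<bar>b\<bar> \<le> 1/8"
        unfolding atLeastAtMost_iff by linarith+
      then have "(r - a)\<^sup>2 \<le> (3/2)\<^sup>2" "b\<^sup>2 \<le> (1/8)\<^sup>2"
        using abs_le_square_iff[of "r - a" "3/2"] abs_le_square_iff[of b "1/8"] by simp_all
      then have "(r - a)\<^sup>2 + (0 - b)\<^sup>2 < 2\<^sup>2"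
        by (simp add: power_divide)
      with True show ?thesis
        by (simp add: orbit_mass_def)
    qed (auto simp: indicator_def)
  qed
  finally show ?thesis .
qed

end

text \<open>The pair of densities models \<open>g = \<bar>u\<bar>\<^sup>2\<close> and \<open>k = \<bar>u\<bar>\<^sup>2 + 2 \<bar>u\<bar> \<bar>\<nabla>u\<bar>\<close>; the last three
  assumptions are the one-dimensional Sobolev embedding along the coordinate axes.\<close>

locale helical_sobolev_pair = g: helical_density g + k: helical_density k
  for g k :: "real \<times> real \<times> real \<Rightarrow> ennreal" +
  assumes sobolev1: "1 \<le> \<beta> - \<alpha> \<Longrightarrow> a \<in> {\<alpha>..\<beta>} \<Longrightarrow> g (a, b, t) \<le> (\<integral>\<^sup>+s\<in>{\<alpha>..\<beta>}. k (s, b, t) \<partial>lborel)"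
    and sobolev2: "1 \<le> \<beta> - \<alpha> \<Longrightarrow> b \<in> {\<alpha>..\<beta>} \<Longrightarrow> g (a, b, t) \<le> (\<integral>\<^sup>+s\<in>{\<alpha>..\<beta>}. k (a, s, t) \<partial>lborel)"
    and sobolev3: "1 \<le> \<beta> - \<alpha> \<Longrightarrow> t \<in> {\<alpha>..\<beta>} \<Longrightarrow> g (a, b, t) \<le> (\<integral>\<^sup>+s\<in>{\<alpha>..\<beta>}. k (a, b, s) \<partial>lborel)"
begin

section \<open>Pointwise and orbit bounds by the mass of \<open>k\<close>\<close>

lemma density_le_orbit_mass:
  assumes "t \<in> {0..<2*pi}"
  shows "g (a, b, t) \<le> orbit_mass k a b"
proof -
  have "1 \<le> 2 * pi - 0"
    using pi_gt3 by linarith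
  then have "g (a, b, t) \<le> (\<integral>\<^sup>+s\<in>{0..2*pi}. k (a, b, s) \<partial>lborel)"
    using assms by (intro sobolev3) auto
  also have "\<dots> = orbit_mass k a b"
    unfolding orbit_mass_def
  \<comment> \<open>The closed interval of the Sobolev bound and the half-open period differ by one
    point, a null set.\<close>
  proof (rule nn_integral_cong_AE)
    have "AE s in lborel. s \<noteq> 2 * pi"
      by (rule AE_lborel_singleton)
    then show "AE s in lborel. k (a, b, s) * indicator {0..2*pi} s = k (a, b, s) * indicator {0..<2*pi} s"
      by eventually_elim (auto simp: indicator_def)
  qed
  finally show ?thesis .
qed

text \<open>One of the two factors \<open>g\<close> is replaced by its vertical bound, which is
  constant in \<open>t\<close>; the other is integrated.\<close>

lemma orbit_mass_square_le: "orbit_mass (\<lambda>p. (g p)\<^sup>2) a b \<le> orbit_mass k a b * orbit_mass g a b"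
proof -
  have "orbit_mass (\<lambda>p. (g p)\<^sup>2) a b \<le>
      (\<integral>\<^sup>+t. orbit_mass k a b * (g (a, b, t) * indicator {0..<2*pi} t) \<partial>lborel)"
    unfolding orbit_mass_def[of "\<lambda>p. (g p)\<^sup>2"]
    by (intro nn_integral_mono) (auto simp: indicator_def power2_eq_square intro!: mult_right_mono density_le_orbit_mass)
  also have "\<dots> = orbit_mass k a b * orbit_mass g a b"
    unfolding orbit_mass_def[of g] by (intro nn_integral_cmult) measurable
  finally show ?thesis .
qed

text \<open>Away from the axis the ball contains a whole strip of lines parallel to the first axis, each of
  which meets the circle through \<open>(a, b)\<close>, on which the orbit mass is constant.\<close>

lemma orbit_mass_le_disc_mass:
  assumes far: "1/16 \<le> a\<^sup>2 + b\<^sup>2" and ball: "(r - a)\<^sup>2 + b\<^sup>2 < 1" and r: "0 \<le> r"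
  shows "orbit_mass g a b \<le> 8 * disc_mass k r 0 2"
proof -
  define \<rho> where "\<rho> = sqrt (a\<^sup>2 + b\<^sup>2)"
  have \<rho>2: "\<rho>\<^sup>2 = a\<^sup>2 + b\<^sup>2" and "0 \<le> \<rho>"
    by (simp_all add: \<rho>_def)
  have "1/4 \<le> \<rho>"
    using real_sqrt_le_mono[OF far] by (simp add: \<rho>_def real_sqrt_divide)
  have "\<bar>a\<bar> \<le> \<rho>"
    unfolding \<rho>_def by (rule real_le_rsqrt) simp
  \<comment> \<open>Reverse triangle inequality in squared form:
    \<open>(\<rho> - r)^2 \<le> (r - a)^2 + b^2 < 1\<close>.\<close>
  have "r * a \<le> r * \<rho>"
    using \<open>\<bar>a\<bar> \<le> \<rho>\<close> r by (intro mult_left_mono) auto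
  then have "(\<rho> - r)\<^sup>2 < 1\<^sup>2"
    using ball \<rho>2 by (simp add: power2_eq_square algebra_simps)
  then have \<rho>r: "\<bar>\<rho> - r\<bar> < 1"
    by (metis abs_le_square_iff abs_one linorder_not_le)
  have main: "orbit_mass g a b \<le> (\<integral>\<^sup>+t\<in>{0..<2*pi}. (\<integral>\<^sup>+s\<in>{r-3/2..r+3/2}. k (s, c, t) \<partial>lborel) \<partial>lborel)"
    if c: "c \<in> {0..1/8}" for c
  proof -
    \<comment> \<open>Since \<open>c \<le> 1/8 < 1/4 \<le> \<rho>\<close>, the line at ordinate
      \<open>c\<close> meets the circle of radius \<open>\<rho>\<close>, at abscissa
      \<open>z\<close>. As \<open>\<rho> - c \<le> z \<le> \<rho>\<close>, the point
      \<open>z\<close> is within \<open>1 + 1/8\<close> of \<open>r\<close>, inside the segment of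
      half-length \<open>3/2\<close>.\<close>
    define z where "z = sqrt (\<rho>\<^sup>2 - c\<^sup>2)"
    have "c\<^sup>2 \<le> \<rho>\<^sup>2"
      using c \<open>1/4 \<le> \<rho>\<close> by (intro power_mono) auto
    then have z2: "z\<^sup>2 = \<rho>\<^sup>2 - c\<^sup>2" and "0 \<le> z"
      unfolding z_def by (simp_all only: diff_ge_0_iff_ge real_sqrt_pow2 real_sqrt_ge_zero)
    have "z \<le> \<rho>"
      by (rule power2_le_imp_le[OF _ \<open>0 \<le> \<rho>\<close>]) (simp add: z2)
    have "0 \<le> z * c"
      using c \<open>0 \<le> z\<close> by simp
    then have "\<rho>\<^sup>2 \<le> (z + c)\<^sup>2"
      unfolding power2_sum z2 by (simp add: mult.commute)
    then have "\<rho> \<le> z + c"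
      by (rule power2_le_imp_le) (use c \<open>0 \<le> z\<close> in simp)
    then have z: "z \<in> {r-3/2..r+3/2}"
      using \<rho>r c \<open>z \<le> \<rho>\<close> unfolding atLeastAtMost_iff by linarith
    have "orbit_mass g a b = orbit_mass g z c"
      by (rule g.orbit_mass_radial) (simp add: z2 \<rho>2)
    also have "\<dots> \<le> (\<integral>\<^sup>+t\<in>{0..<2*pi}. (\<integral>\<^sup>+s\<in>{r-3/2..r+3/2}. k (s, c, t) \<partial>lborel) \<partial>lborel)"
      unfolding orbit_mass_def using z
      by (intro nn_integral_mono mult_right_mono sobolev1) auto
    finally show ?thesis .
  qed
  \<comment> \<open>The bound holds for every \<open>c\<close> with the same left side; integrating
    over a strip of width \<open>1/8\<close> produces the factor 8.\<close>
  have "orbit_mass g a b * ennreal (1/8) = (\<integral>\<^sup>+c. orbit_mass g a b * indicator {0..1/8::real} c \<partial>lborel)"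
    by (subst nn_integral_cmult_indicator) simp_all
  also have "\<dots> \<le> (\<integral>\<^sup>+c\<in>{0..1/8}. (\<integral>\<^sup>+t\<in>{0..<2*pi}. (\<integral>\<^sup>+s\<in>{r-3/2..r+3/2}. k (s, c, t) \<partial>lborel) \<partial>lborel) \<partial>lborel)"
    by (intro nn_integral_mono) (auto simp: indicator_def intro: main[simplified])
  also have "\<dots> \<le> disc_mass k r 0 2"
    by (rule k.box_le_disc_mass)
  finally have "8 * (orbit_mass g a b * ennreal (1/8)) \<le> 8 * disc_mass k r 0 2"
    by (intro mult_left_mono) auto
  moreover have "8 * (orbit_mass g a b * ennreal (1/8)) = orbit_mass g a b * (ennreal 8 * ennreal (1/8))"
    by (simp add: ac_simps)
  moreover have "ennreal 8 * ennreal (1/8) = 1"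
    by (subst ennreal_mult[symmetric]) simp_all
  ultimately show ?thesis
    by simp
qed

text \<open>Two-dimensional Ladyzhenskaya inequality in a horizontal slice: one factor is integrated over
  each of the two coordinates.\<close>

lemma slice_square_le:
  "(\<integral>\<^sup>+a. \<integral>\<^sup>+b. (g (a, b, t))\<^sup>2 * indicator {z. z < 1/16} (a\<^sup>2 + b\<^sup>2) \<partial>lborel \<partial>lborel) \<le>
   (\<integral>\<^sup>+a. \<integral>\<^sup>+b. k (a, b, t) * indicator {z. z < 9/16} (a\<^sup>2 + b\<^sup>2) \<partial>lborel \<partial>lborel)\<^sup>2" (is "_ \<le> ?K\<^sup>2")
proof -
  \<comment> \<open>Length 1 is what the Sobolev bounds require. The square with this side contains
    the disc of radius \<open>1/4\<close> and lies in the disc of radius \<open>3/4\<close>, as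
    \<open>1/4 + 1/4 < 9/16\<close>.\<close>
  let ?I = "{-1/2..1/2::real}"
  define X where "X b = (\<integral>\<^sup>+s\<in>?I. k (s, b, t) \<partial>lborel) * indicator ?I b" for b
  define Y where "Y a = (\<integral>\<^sup>+s\<in>?I. k (a, s, t) \<partial>lborel) * indicator ?I a" for a
  have [measurable]: "X \<in> borel_measurable borel" "Y \<in> borel_measurable borel"
    unfolding X_def Y_def by measurable
  have Q: "(\<integral>\<^sup>+a. \<integral>\<^sup>+b. k (a, b, t) * indicator ?I a * indicator ?I b \<partial>lborel \<partial>lborel) \<le> ?K"
  proof (intro nn_integral_mono)
    fix a b :: real
    show "k (a, b, t) * indicator ?I a * indicator ?I b \<le> k (a, b, t) * indicator {z. z < 9/16} (a\<^sup>2 + b\<^sup>2)"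
    proof (cases "a \<in> ?I \<and> b \<in> ?I")
      case True
      then have "\<bar>a\<bar> \<le> 1/2" "\<bar>b\<bar> \<le> 1/2"
        unfolding atLeastAtMost_iff by linarith+
      then have "a\<^sup>2 \<le> (1/2)\<^sup>2" "b\<^sup>2 \<le> (1/2)\<^sup>2"
        using abs_le_square_iff[of a "1/2"] abs_le_square_iff[of b "1/2"] by simp_all
      then have "a\<^sup>2 + b\<^sup>2 < 9/16"
        by (simp add: power_divide)
      with True show ?thesis by simp
    qed (auto simp: indicator_def)
  qed
  have "(\<integral>\<^sup>+a. \<integral>\<^sup>+b. (g (a, b, t))\<^sup>2 * indicator {z. z < 1/16} (a\<^sup>2 + b\<^sup>2) \<partial>lborel \<partial>lborel) \<le>
      (\<integral>\<^sup>+a. \<integral>\<^sup>+b. Y a * X b \<partial>lborel \<partial>lborel)"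
  proof (intro nn_integral_mono)
    fix a b :: real
    show "(g (a, b, t))\<^sup>2 * indicator {z. z < 1/16} (a\<^sup>2 + b\<^sup>2) \<le> Y a * X b"
    proof (cases "a\<^sup>2 + b\<^sup>2 < 1/16")
      case True
      have "a\<^sup>2 \<le> (1/2)\<^sup>2" "b\<^sup>2 \<le> (1/2)\<^sup>2"
        using True zero_le_power2[of a] zero_le_power2[of b] unfolding power_divide one_power2 power2_eq_square[of 2]
        by linarith+
      then have "\<bar>a\<bar> \<le> 1/2" "\<bar>b\<bar> \<le> 1/2"
        using abs_le_square_iff[of a "1/2"] abs_le_square_iff[of b "1/2"] by simp_all
      then have I: "a \<in> ?I" "b \<in> ?I"
        unfolding atLeastAtMost_iff by linarith+
      have "g (a, b, t) * g (a, b, t) \<le> (\<integral>\<^sup>+s\<in>?I. k (a, s, t) \<partial>lborel) * (\<integral>\<^sup>+s\<in>?I. k (s, b, t) \<partial>lborel)"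
        by (intro mult_mono sobolev1 sobolev2 I) auto
      then show ?thesis
        using True I by (simp add: X_def Y_def power2_eq_square)
    qed simp
  qed
  also have "\<dots> = (\<integral>\<^sup>+a. Y a \<partial>lborel) * (\<integral>\<^sup>+b. X b \<partial>lborel)"
    by (simp add: nn_integral_cmult nn_integral_multc)
  also have "(\<integral>\<^sup>+a. Y a \<partial>lborel) = (\<integral>\<^sup>+a. \<integral>\<^sup>+b. k (a, b, t) * indicator ?I a * indicator ?I b \<partial>lborel \<partial>lborel)"
    unfolding Y_def
    by (intro nn_integral_cong, subst nn_integral_multc[symmetric]) (measurable, simp add: ac_simps)
  also have "(\<integral>\<^sup>+b. X b \<partial>lborel) = (\<integral>\<^sup>+b. \<integral>\<^sup>+a. k (a, b, t) * indicator ?I a * indicator ?I b \<partial>lborel \<partial>lborel)"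
    unfolding X_def by (intro nn_integral_cong) (simp add: nn_integral_multc)
  also have "\<dots> = (\<integral>\<^sup>+a. \<integral>\<^sup>+b. k (a, b, t) * indicator ?I a * indicator ?I b \<partial>lborel \<partial>lborel)"
    by (intro lborel_pair.Fubini') measurable
  also have "(\<integral>\<^sup>+a. \<integral>\<^sup>+b. k (a, b, t) * indicator ?I a * indicator ?I b \<partial>lborel \<partial>lborel) *
      (\<integral>\<^sup>+a. \<integral>\<^sup>+b. k (a, b, t) * indicator ?I a * indicator ?I b \<partial>lborel \<partial>lborel) \<le> ?K\<^sup>2"
    unfolding power2_eq_square[of ?K] by (intro mult_mono Q) auto
  finally show ?thesis .
qed

text \<open>The slice inequality is integrated over the height. Its right side is the same number
  \<open>m^2\<close> at each height, and \<open>2 * pi * m\<close> is controlled by the mass of the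
  large cylinder.\<close>

lemma axis_square_le:
  assumes "0 \<le> r" "r < 5/4"
  shows "(\<integral>\<^sup>+a. \<integral>\<^sup>+b. orbit_mass (\<lambda>p. (g p)\<^sup>2) a b * indicator {z. z < 1/16} (a\<^sup>2 + b\<^sup>2) \<partial>lborel \<partial>lborel)
    \<le> (disc_mass k r 0 2)\<^sup>2"
proof -
  define f where "f = (\<lambda>(a, b, t). (g (a, b, t))\<^sup>2 * indicator {z. z < 1/16} (a\<^sup>2 + b\<^sup>2) *
    indicator {0..<2*pi::real} t)"
  have [measurable]: "f \<in> borel_measurable (borel \<Otimes>\<^sub>M borel \<Otimes>\<^sub>M borel)"
    unfolding f_def by measurable
  define m where "m = (\<integral>\<^sup>+a. \<integral>\<^sup>+b. k (a, b, 0) * indicator {z. z < 9/16} (a\<^sup>2 + b\<^sup>2) \<partial>lborel \<partial>lborel)"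
  have "(\<integral>\<^sup>+a. \<integral>\<^sup>+b. orbit_mass (\<lambda>p. (g p)\<^sup>2) a b * indicator {z. z < 1/16} (a\<^sup>2 + b\<^sup>2) \<partial>lborel \<partial>lborel)
      = (\<integral>\<^sup>+a. \<integral>\<^sup>+b. \<integral>\<^sup>+t. f (a, b, t) \<partial>lborel \<partial>lborel \<partial>lborel)"
    unfolding f_def orbit_mass_def
    by (intro nn_integral_cong) (simp add: nn_integral_multc[symmetric] ac_simps)
  also have "\<dots> = (\<integral>\<^sup>+t. \<integral>\<^sup>+a. \<integral>\<^sup>+b. f (a, b, t) \<partial>lborel \<partial>lborel \<partial>lborel)"
    by (rule nn_integral_rotate_coords) measurable
  also have "\<dots> \<le> (\<integral>\<^sup>+t. m\<^sup>2 * indicator {0..<2*pi::real} t \<partial>lborel)"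
  proof (intro nn_integral_mono)
    fix t :: real
    show "(\<integral>\<^sup>+a. \<integral>\<^sup>+b. f (a, b, t) \<partial>lborel \<partial>lborel) \<le> m\<^sup>2 * indicator {0..<2*pi} t"
      using slice_square_le[of t] k.nn_integral_slice[of t "9/16"]
      by (cases "t \<in> {0..<2*pi}") (simp_all add: f_def m_def)
  qed
  also have "\<dots> = m\<^sup>2 * ennreal (2 * pi)"
    by (subst nn_integral_cmult_indicator) simp_all
  \<comment> \<open>A spare factor \<open>2 * pi\<close>, which is at least 1, completes the square
    of \<open>2 * pi * m\<close>.\<close>
  also have "\<dots> \<le> m\<^sup>2 * (ennreal (2 * pi))\<^sup>2"
  proof -
    have "1 \<le> 2 * pi"
      using pi_gt3 by linarith
    then have "2 * pi * 1 \<le> 2 * pi * (2 * pi)"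
      by (intro mult_left_mono) auto
    then have "ennreal (2 * pi) \<le> ennreal ((2 * pi)\<^sup>2)"
      by (intro ennreal_leI) (simp only: power2_eq_square mult_1_right)
    also have "\<dots> = (ennreal (2 * pi))\<^sup>2"
      by (rule ennreal_power[symmetric]) simp
    finally show ?thesis
      by (intro mult_left_mono) simp_all
  qed
  also have "\<dots> = (ennreal (2 * pi) * m)\<^sup>2"
    by (simp add: power_mult_distrib mult.commute)
  also have "\<dots> \<le> (disc_mass k r 0 2)\<^sup>2"
    unfolding m_def by (intro power_mono k.slice_le_disc_mass assms) auto
  finally show ?thesis .
qed

text \<open>The constant is \<open>8 + 1\<close>: 8 from the points at distance at least
  \<open>1/4\<close> from the axis, 1 from those nearer.\<close>

theorem disc_mass_square_le:
  assumes r: "0 \<le> r"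
  shows "disc_mass (\<lambda>p. (g p)\<^sup>2) r 0 1 \<le> 9 * (disc_mass k r 0 2)\<^sup>2"
proof -
  let ?M = "disc_mass k r 0 2"
  \<comment> \<open>\<open>?far\<close> is cut off at radius 2 rather than 1, so that it integrates
    to \<open>8 * ?M * ?M\<close>. \<open>?near\<close> carries \<open>r < 5/4\<close>, the
    hypothesis of \<open>axis_square_le\<close>: only then does the unit disc about
    \<open>(r, 0)\<close> reach points within \<open>1/4\<close> of the axis.\<close>
  let ?far = "\<lambda>a b. 8 * ?M * (orbit_mass k a b * indicator {z. z < 2\<^sup>2} ((r - a)\<^sup>2 + (0 - b)\<^sup>2))"
  let ?near = "\<lambda>a b. orbit_mass (\<lambda>p. (g p)\<^sup>2) a b * (indicator {z. z < 1/16} (a\<^sup>2 + b\<^sup>2) * indicator {..<5/4} r)"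
  have [measurable]: "(\<lambda>(a, b). orbit_mass (\<lambda>p. (g p)\<^sup>2) a b) \<in> borel_measurable (borel \<Otimes>\<^sub>M borel)"
    unfolding orbit_mass_def by measurable
  have "disc_mass (\<lambda>p. (g p)\<^sup>2) r 0 1 \<le> (\<integral>\<^sup>+a. \<integral>\<^sup>+b. ?far a b + ?near a b \<partial>lborel \<partial>lborel)"
    unfolding disc_mass_def[of "\<lambda>p. (g p)\<^sup>2"]
  proof (intro nn_integral_mono)
    fix a b :: real
    show "orbit_mass (\<lambda>p. (g p)\<^sup>2) a b * indicator {z. z < 1\<^sup>2} ((r - a)\<^sup>2 + (0 - b)\<^sup>2) \<le> ?far a b + ?near a b"
    proof (cases "(r - a)\<^sup>2 + b\<^sup>2 < 1")
      case ball: True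
      show ?thesis
      proof (cases "a\<^sup>2 + b\<^sup>2 < 1/16")
        case True
        have "\<bar>a\<bar> < 1/4"
        proof (rule power2_less_imp_less)
          show "\<bar>a\<bar>\<^sup>2 < (1/4)\<^sup>2"
            using True zero_le_power2[of b] unfolding power2_abs power_divide one_power2 power2_eq_square[of 4]
            by linarith
        qed simp
        moreover have "\<bar>r - a\<bar> < 1"
        proof (rule power2_less_imp_less)
          show "\<bar>r - a\<bar>\<^sup>2 < 1\<^sup>2"
            using ball zero_le_power2[of b] unfolding power2_abs one_power2 by linarith
        qed simp
        ultimately have "r < 5/4"
          by linarith
        then show ?thesis
          using True by (simp add: indicator_def)
      next
        case False
        have "orbit_mass (\<lambda>p. (g p)\<^sup>2) a b \<le> orbit_mass k a b * orbit_mass g a b"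
          by (rule orbit_mass_square_le)
        also have "\<dots> \<le> orbit_mass k a b * (8 * ?M)"
          using False ball r by (intro mult_left_mono orbit_mass_le_disc_mass) auto
        finally show ?thesis
          using ball by (simp add: ac_simps add_increasing2)
      qed
    qed simp
  qed
  also have "\<dots> = (\<integral>\<^sup>+a. (\<integral>\<^sup>+b. ?far a b \<partial>lborel) + (\<integral>\<^sup>+b. ?near a b \<partial>lborel) \<partial>lborel)"
    by (intro nn_integral_cong nn_integral_add) measurable
  also have "\<dots> = (\<integral>\<^sup>+a. \<integral>\<^sup>+b. ?far a b \<partial>lborel \<partial>lborel) + (\<integral>\<^sup>+a. \<integral>\<^sup>+b. ?near a b \<partial>lborel \<partial>lborel)"
    by (intro nn_integral_add) measurable
  also have "(\<integral>\<^sup>+a. \<integral>\<^sup>+b. ?far a b \<partial>lborel \<partial>lborel) = 8 * ?M * ?M"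
    unfolding disc_mass_def[of k] by (simp add: nn_integral_cmult)
  also have "(\<integral>\<^sup>+a. \<integral>\<^sup>+b. ?near a b \<partial>lborel \<partial>lborel) \<le> ?M\<^sup>2"
    using axis_square_le[OF r] by (cases "r < 5/4") simp_all
  also have "8 * ?M * ?M + ?M\<^sup>2 = 9 * ?M\<^sup>2"
  proof -
    have "8 * ?M * ?M + ?M\<^sup>2 = (8 + 1) * ?M\<^sup>2"
      by (simp only: distrib_right power2_eq_square mult_1 mult.assoc)
    then show ?thesis by simp
  qed
  finally show ?thesis
    by (simp add: add_left_mono)
qed

end

section \<open>Helical vector fields\<close>

text \<open>The Frobenius norm dominates the operator norm, by Cauchy-Schwarz in each row.\<close>

lemma norm_matrix_vector_le:
  fixes A :: "real^'n^'m"
  shows "norm (A *v w) \<le> norm A * norm w"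
proof -
  have "norm (A *v w) = L2_set (\<lambda>i. \<bar>(A $ i) \<bullet> w\<bar>) UNIV"
    by (simp add: norm_vec_def[of "A *v w"] matrix_vector_mul_component)
  also have "\<dots> \<le> L2_set (\<lambda>i. norm (A $ i) * norm w) UNIV"
    by (intro L2_set_mono Cauchy_Schwarz_ineq2) auto
  also have "\<dots> = norm A * norm w"
    by (simp add: norm_vec_def[of A] L2_set_left_distrib)
  finally show ?thesis .
qed

lemma norm_real3: "norm (v :: real^3) = sqrt ((v$1)\<^sup>2 + (v$2)\<^sup>2 + (v$3)\<^sup>2)"
  by (simp add: norm_vec_def L2_set_def sum_3)

lemma norm_real33: "norm (A :: real^3^3) = sqrt ((norm (A$1))\<^sup>2 + (norm (A$2))\<^sup>2 + (norm (A$3))\<^sup>2)"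
  by (simp add: norm_vec_def[of A] L2_set_def sum_3)

lemma rot_vector_mult:
  "rot \<theta> *v v = vector [cos \<theta> * v$1 + sin \<theta> * v$2, cos \<theta> * v$2 - sin \<theta> * v$1, v$3]"
  by (simp add: vec_eq_iff forall_3 rot_def matrix_vector_mult_def sum_3)

lemma rotated_squares_sum:
  "(cos \<theta> * a + sin \<theta> * b)\<^sup>2 + (cos \<theta> * b - sin \<theta> * a)\<^sup>2 = a\<^sup>2 + b\<^sup>2" for a b \<theta> :: real
proof -
  have "(cos \<theta> * a + sin \<theta> * b)\<^sup>2 + (cos \<theta> * b - sin \<theta> * a)\<^sup>2 = ((cos \<theta>)\<^sup>2 + (sin \<theta>)\<^sup>2) * (a\<^sup>2 + b\<^sup>2)"
    by (simp only: power2_eq_square) (simp only: algebra_simps)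
  then show ?thesis by simp
qed

lemma norm_rot_vector: "norm (rot \<theta> *v v) = norm v"
  by (simp add: rot_vector_mult norm_real3 rotated_squares_sum)

text \<open>The first two entries of each column undergo a plane rotation.\<close>

lemma norm_rot_matrix: "norm (rot \<theta> ** (A :: real^3^3)) = norm A"
proof -
  have "(norm (rot \<theta> ** A))\<^sup>2 = (norm A)\<^sup>2"
    using rotated_squares_sum[of \<theta> "A$1$1" "A$2$1"] rotated_squares_sum[of \<theta> "A$1$2" "A$2$2"]
      rotated_squares_sum[of \<theta> "A$1$3" "A$2$3"]
    by (simp add: norm_real33 norm_real3 rot_def matrix_matrix_mult_def sum_3)
  then show ?thesis by simp
qed

text \<open>Here the rows are rotated, by the opposite angle.\<close>

lemma norm_matrix_rot: "norm ((A :: real^3^3) ** rot \<theta>) = norm A"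
proof -
  have "norm ((A ** rot \<theta>) $ i) = norm (A $ i)" for i
    using rotated_squares_sum[of "- \<theta>" "A$i$1" "A$i$2"]
    by (simp add: norm_real3 rot_def matrix_matrix_mult_def sum_3 algebra_simps)
  then show ?thesis
    by (simp add: norm_real33)
qed

lemma screw_vector:
  "screw \<theta> (vector [a, b, t]) = vector [cos \<theta> * a + sin \<theta> * b, cos \<theta> * b - sin \<theta> * a, t + \<theta>]"
  by (simp add: screw_def rot_vector_mult vec_eq_iff forall_3)

section \<open>Gradients of smooth helical fields\<close>

lemma has_derivative_grad:
  assumes "smooth u"
  shows "(u has_derivative (\<lambda>h. grad u x *v h)) (at x)"
proof -
  have "k_times_cont_differentiable 1 u"
    using assms by (simp only: smooth_def)
  then have "u differentiable (at x)"
    by simp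
  then show ?thesis
    by (simp add: grad_def jacobian_works)
qed

lemma continuous_on_smooth:
  assumes "smooth u"
  shows "continuous_on UNIV u"
proof -
  have "k_times_cont_differentiable 0 u"
    using assms by (simp only: smooth_def)
  then show ?thesis by simp
qed

lemma continuous_on_grad:
  assumes "smooth u"
  shows "continuous_on UNIV (grad u)"
proof -
  have "k_times_cont_differentiable (Suc 0) u"
    using assms by (simp only: smooth_def)
  then have "continuous_on UNIV (\<lambda>x. frechet_derivative u (at x) v)" for v
    by simp
  then show ?thesis
    unfolding grad_def jacobian_def matrix_def
    by (intro continuous_on_vec_lambda continuous_on_component)
qed

text \<open>Differentiating the helical identity and using uniqueness of derivatives gives
  \<open>rot \<theta> ** grad u x = grad u (screw \<theta> x) ** rot \<theta>\<close>;
  multiplication by a rotation on either side preserves the Frobenius norm.\<close>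

lemma norm_grad_screw:
  assumes "smooth u" "helical u"
  shows "norm (grad u (screw \<theta> x)) = norm (grad u x)"
proof -
  have 1: "((\<lambda>y. rot \<theta> *v u y) has_derivative (\<lambda>h. rot \<theta> *v (grad u x *v h))) (at x)"
    by (rule bounded_linear.has_derivative[OF matrix_vector_mul_bounded_linear has_derivative_grad[OF assms(1)]])
  have "(screw \<theta> has_derivative (\<lambda>h. rot \<theta> *v h)) (at x)"
    unfolding screw_def[abs_def]
    by (rule has_derivative_add_const[OF bounded_linear.has_derivative[OF matrix_vector_mul_bounded_linear has_derivative_ident]])
  from has_derivative_compose[OF this has_derivative_grad[OF assms(1)]]
  have 2: "((\<lambda>y. u (screw \<theta> y)) has_derivative (\<lambda>h. grad u (screw \<theta> x) *v (rot \<theta> *v h))) (at x)" .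
  have "(\<lambda>y. rot \<theta> *v u y) = (\<lambda>y. u (screw \<theta> y))"
    using assms(2) by (simp add: helical_def)
  with 1 2 have "(\<lambda>h. rot \<theta> *v (grad u x *v h)) = (\<lambda>h. grad u (screw \<theta> x) *v (rot \<theta> *v h))"
    using has_derivative_unique by metis
  then have "rot \<theta> ** grad u x = grad u (screw \<theta> x) ** rot \<theta>"
    by (simp add: matrix_eq matrix_vector_mul_assoc fun_eq_iff)
  then show ?thesis
    using norm_rot_matrix norm_matrix_rot by metis
qed

lemma norm_screw:
  assumes "helical u"
  shows "norm (u (screw \<theta> x)) = norm (u x)"
proof -
  have "u (screw \<theta> x) = rot \<theta> *v u x"
    using assms by (simp add: helical_def)
  then show ?thesis
    by (simp add: norm_rot_vector)
qed

text \<open>The second term dominates the derivative of \<open>(norm (u y))^2\<close> in every unit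
  direction.\<close>

definition energy_density :: "(real^3 \<Rightarrow> real^3) \<Rightarrow> real^3 \<Rightarrow> real" where
  "energy_density u y = (norm (u y))\<^sup>2 + 2 * norm (u y) * norm (grad u y)"

lemma sobolev_on_line:
  assumes u: "smooth u" and w: "norm w = 1" and p: "p \<in> {\<alpha>..\<beta>}" and len: "1 \<le> \<beta> - \<alpha>"
  shows "ennreal ((norm (u (q + p *\<^sub>R w)))\<^sup>2) \<le>
    (\<integral>\<^sup>+s\<in>{\<alpha>..\<beta>}. ennreal (energy_density u (q + s *\<^sub>R w)) \<partial>lborel)"
  unfolding energy_density_def
proof (rule agmon_interval[OF _ _ _ _ _ p len])
  let ?x = "\<lambda>s. q + s *\<^sub>R w"
  let ?\<phi>' = "\<lambda>s. 2 * (u (?x s) \<bullet> (grad u (?x s) *v w))"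
  fix s
  have line: "(?x has_derivative (\<lambda>h. h *\<^sub>R w)) (at s)"
    by (auto intro!: derivative_eq_intros)
  note D = has_derivative_compose[OF line has_derivative_grad[OF u]]
  have "((\<lambda>s. u (?x s) \<bullet> u (?x s)) has_derivative (\<lambda>h. ?\<phi>' s * h)) (at s)"
    by (rule has_derivative_eq_rhs[OF has_derivative_inner[OF D D]])
       (simp add: fun_eq_iff matrix_vector_mult_scaleR inner_commute)
  then show "((\<lambda>s. (norm (u (?x s)))\<^sup>2) has_real_derivative ?\<phi>' s) (at s)"
    by (simp add: has_field_derivative_def power2_norm_eq_inner)
  have "\<bar>u (?x s) \<bullet> (grad u (?x s) *v w)\<bar> \<le> norm (u (?x s)) * norm (grad u (?x s) *v w)"
    by (rule Cauchy_Schwarz_ineq2)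
  also have "\<dots> \<le> norm (u (?x s)) * norm (grad u (?x s))"
    using norm_matrix_vector_le[of "grad u (?x s)" w] w by (intro mult_left_mono) auto
  finally show "\<bar>?\<phi>' s\<bar> \<le> 2 * norm (u (?x s)) * norm (grad u (?x s))"
    by (simp add: abs_mult)
next
  let ?x = "\<lambda>s. q + s *\<^sub>R w"
  have x: "continuous_on UNIV ?x"
    by (intro continuous_intros)
  have cu: "continuous_on UNIV (\<lambda>s. u (?x s))"
    by (rule continuous_on_compose2[OF continuous_on_smooth[OF u] x]) simp
  have cg: "continuous_on UNIV (\<lambda>s. grad u (?x s))"
    by (rule continuous_on_compose2[OF continuous_on_grad[OF u] x]) simp
  have "continuous_on UNIV (\<lambda>s. grad u (?x s) *v w)"
    unfolding matrix_vector_mult_def using cg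
    by (intro continuous_on_vec_lambda continuous_on_sum continuous_on_mult continuous_on_component continuous_on_const)
  with cu show "continuous_on UNIV (\<lambda>s. 2 * (u (?x s) \<bullet> (grad u (?x s) *v w)))"
    by (intro continuous_intros)
  show "continuous_on UNIV (\<lambda>s. 2 * norm (u (?x s)) * norm (grad u (?x s)))"
    using cu cg by (intro continuous_intros)
qed simp

lemma measurable_coordinates:
  assumes "continuous_on UNIV (F :: real^3 \<Rightarrow> real)"
  shows "(\<lambda>(a, b, t). ennreal (F (vector [a, b, t]))) \<in> borel_measurable (borel \<Otimes>\<^sub>M borel \<Otimes>\<^sub>M borel)"
proof -
  have "continuous_on UNIV (\<lambda>p::real \<times> real \<times> real. vector [fst p, fst (snd p), snd (snd p)] :: real^3)"
    by (intro continuous_on_vector3 continuous_intros)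
  from continuous_on_compose2[OF assms this]
  have "(\<lambda>p::real \<times> real \<times> real. F (vector [fst p, fst (snd p), snd (snd p)])) \<in> borel_measurable borel"
    by (intro borel_measurable_continuous_onI) simp
  then show ?thesis
    by (simp add: borel_prod split_beta')
qed

lemma helical_density_of_screw:
  assumes "continuous_on UNIV F" "\<And>\<theta> x. F (screw \<theta> x) = F x"
  shows "helical_density (\<lambda>(a, b, t). ennreal (F (vector [a, b, t])))"
proof
  show "(\<lambda>(a, b, t). ennreal (F (vector [a, b, t]))) \<in> borel_measurable (borel \<Otimes>\<^sub>M borel \<Otimes>\<^sub>M borel)"
    by (rule measurable_coordinates) fact
qed (use assms(2) in \<open>simp flip: screw_vector\<close>)

lemma continuous_on_energy_density:
  assumes "smooth u"
  shows "continuous_on UNIV (energy_density u)"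
  unfolding energy_density_def[abs_def]
  using continuous_on_smooth[OF assms] continuous_on_grad[OF assms] by (intro continuous_intros)

lemma helical_sobolev_pair_of_field:
  assumes "smooth u" "helical u"
  shows "helical_sobolev_pair (\<lambda>(a, b, t). ennreal ((norm (u (vector [a, b, t])))\<^sup>2))
    (\<lambda>(a, b, t). ennreal (energy_density u (vector [a, b, t])))"
proof (intro helical_sobolev_pair.intro helical_density_of_screw helical_sobolev_pair_axioms.intro)
  show "continuous_on UNIV (\<lambda>y. (norm (u y))\<^sup>2)"
    using continuous_on_smooth[OF assms(1)] by (intro continuous_intros)
  show "continuous_on UNIV (energy_density u)"
    by (rule continuous_on_energy_density[OF assms(1)])
  show "(norm (u (screw \<theta> x)))\<^sup>2 = (norm (u x))\<^sup>2" "energy_density u (screw \<theta> x) = energy_density u x" for \<theta> x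
    using assms by (simp_all add: energy_density_def norm_screw norm_grad_screw)
next
  fix \<alpha> \<beta> a b t :: real
  assume I: "1 \<le> \<beta> - \<alpha>" "a \<in> {\<alpha>..\<beta>}"
  \<comment> \<open>The base point has coordinate 0 along the line, so the line parameter is the
    coordinate itself; the other two axes are treated alike.\<close>
  have "vector [0, b, t] + s *\<^sub>R (axis 1 1 :: real^3) = vector [s, b, t]" for s
    by (simp add: vec_eq_iff forall_3 axis_def)
  with sobolev_on_line[OF assms(1) _ I(2,1), of "axis 1 1" "vector [0, b, t]"]
  show "(case (a, b, t) of (a, b, t) \<Rightarrow> ennreal ((norm (u (vector [a, b, t])))\<^sup>2)) \<le>
    (\<integral>\<^sup>+s\<in>{\<alpha>..\<beta>}. (case (s, b, t) of (a, b, t) \<Rightarrow> ennreal (energy_density u (vector [a, b, t]))) \<partial>lborel)"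
    by (simp add: norm_axis_1)
next
  fix \<alpha> \<beta> a b t :: real
  assume I: "1 \<le> \<beta> - \<alpha>" "b \<in> {\<alpha>..\<beta>}"
  have "vector [a, 0, t] + s *\<^sub>R (axis 2 1 :: real^3) = vector [a, s, t]" for s
    by (simp add: vec_eq_iff forall_3 axis_def)
  with sobolev_on_line[OF assms(1) _ I(2,1), of "axis 2 1" "vector [a, 0, t]"]
  show "(case (a, b, t) of (a, b, t) \<Rightarrow> ennreal ((norm (u (vector [a, b, t])))\<^sup>2)) \<le>
    (\<integral>\<^sup>+s\<in>{\<alpha>..\<beta>}. (case (a, s, t) of (a, b, t) \<Rightarrow> ennreal (energy_density u (vector [a, b, t]))) \<partial>lborel)"
    by (simp add: norm_axis_1)
next
  fix \<alpha> \<beta> a b t :: real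
  assume I: "1 \<le> \<beta> - \<alpha>" "t \<in> {\<alpha>..\<beta>}"
  have "vector [a, b, 0] + s *\<^sub>R (axis 3 1 :: real^3) = vector [a, b, s]" for s
    by (simp add: vec_eq_iff forall_3 axis_def)
  with sobolev_on_line[OF assms(1) _ I(2,1), of "axis 3 1" "vector [a, b, 0]"]
  show "(case (a, b, t) of (a, b, t) \<Rightarrow> ennreal ((norm (u (vector [a, b, t])))\<^sup>2)) \<le>
    (\<integral>\<^sup>+s\<in>{\<alpha>..\<beta>}. (case (a, b, s) of (a, b, t) \<Rightarrow> ennreal (energy_density u (vector [a, b, t]))) \<partial>lborel)"
    by (simp add: norm_axis_1)
qed

section \<open>Integrals over a period of a cylinder and Lebesgue norms\<close>

abbreviation (input) cell :: "real^3 \<Rightarrow> real \<Rightarrow> (real^3) set" where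
  "cell x l \<equiv> cylinder x l \<inter> {y. 0 \<le> y$3 \<and> y$3 < 2 * pi}"

lemma measurable_cell [measurable]: "cell x l \<in> sets borel"
proof -
  have [measurable]: "(\<lambda>y::real^3. y $ i) \<in> borel_measurable borel" for i
    by (intro borel_measurable_continuous_onI continuous_on_component continuous_on_id)
  show ?thesis
    unfolding cylinder_def by measurable
qed

lemma bounded_cell: "bounded (cell x l)"
proof (rule boundedI)
  fix y
  assume y: "y \<in> cell x l"
  have "\<bar>x$1 - y$1\<bar> \<le> l" "\<bar>x$2 - y$2\<bar> \<le> l"
    using y real_sqrt_ge_abs1[of "x$1 - y$1" "x$2 - y$2"] real_sqrt_ge_abs2[of "x$2 - y$2" "x$1 - y$1"]
    unfolding cylinder_def Int_iff mem_Collect_eq by linarith+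
  moreover have "\<bar>y$3\<bar> \<le> 2 * pi"
    using y by auto
  moreover have "norm y \<le> (\<Sum>i\<in>UNIV. \<bar>y$i\<bar>)"
    by (rule norm_le_l1_cart)
  ultimately show "norm y \<le> (\<bar>x$1\<bar> + l) + (\<bar>x$2\<bar> + l) + 2 * pi"
    unfolding sum_3 by linarith
qed

text \<open>A continuous function is bounded on the compact closure of the cell. Finiteness matters
  because \<open>enn2real\<close> sends \<open>\<infinity>\<close> to 0, which would break the
  return to real norms.\<close>

lemma nn_integral_cell_finite:
  assumes "continuous_on UNIV (F :: real^3 \<Rightarrow> real)"
  shows "(\<integral>\<^sup>+y\<in>cell x l. ennreal (F y) \<partial>lborel) < \<infinity>"
proof -
  have "compact (closure (cell x l))"
    using bounded_cell by (simp add: compact_closure)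
  then have "compact (F ` closure (cell x l))"
    using assms by (intro compact_continuous_image) (auto intro: continuous_on_subset)
  then obtain B where B: "\<forall>z \<in> F ` closure (cell x l). norm z \<le> B"
    using compact_imp_bounded[of "F ` closure (cell x l)"] unfolding bounded_iff by blast
  have "F y \<le> B" if "y \<in> cell x l" for y
  proof -
    have "F y \<in> F ` closure (cell x l)"
      using that closure_subset[of "cell x l"] by blast
    with B have "norm (F y) \<le> B"
      by (rule bspec)
    then show ?thesis
      by simp
  qed
  then have "(\<integral>\<^sup>+y\<in>cell x l. ennreal (F y) \<partial>lborel) \<le> (\<integral>\<^sup>+y\<in>cell x l. ennreal B \<partial>lborel)"
    by (intro nn_integral_mono) (auto simp: indicator_def intro: ennreal_leI)
  also have "\<dots> = ennreal B * emeasure lborel (cell x l)"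
    by (subst nn_integral_cmult_indicator) simp_all
  also have "\<dots> < \<infinity>"
    using emeasure_bounded_finite[OF bounded_cell] by (simp add: ennreal_mult_less_top)
  finally show ?thesis .
qed

text \<open>Tonelli in coordinates. Positivity of \<open>l\<close> makes the bound on the distance
  equivalent to the one on its square.\<close>

lemma nn_integral_cell:
  assumes F: "continuous_on UNIV (F :: real^3 \<Rightarrow> real)" and l: "0 < l"
  shows "(\<integral>\<^sup>+y\<in>cell x l. ennreal (F y) \<partial>lborel) =
    disc_mass (\<lambda>(a, b, t). ennreal (F (vector [a, b, t]))) (x$1) (x$2) l"
proof -
  have [measurable]: "F \<in> borel_measurable borel"
    using F by (rule borel_measurable_continuous_onI)
  have Mt: "(\<lambda>t. ennreal (F (vector [a, b, t]))) \<in> borel_measurable lborel" for a b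
  proof -
    have "continuous_on UNIV (\<lambda>t. vector [a, b, t] :: real^3)"
      by (intro continuous_on_vector3 continuous_intros)
    from continuous_on_compose2[OF F this] show ?thesis
      by (intro measurable_compose[OF _ measurable_ennreal]) (simp add: borel_measurable_continuous_onI)
  qed
  have "(\<integral>\<^sup>+y\<in>cell x l. ennreal (F y) \<partial>lborel) =
      (\<integral>\<^sup>+a. \<integral>\<^sup>+b. \<integral>\<^sup>+t. ennreal (F (vector [a, b, t])) * indicator (cell x l) (vector [a, b, t]) \<partial>lborel \<partial>lborel \<partial>lborel)"
    by (rule nn_integral_real3) measurable
  also have "\<dots> = disc_mass (\<lambda>(a, b, t). ennreal (F (vector [a, b, t]))) (x$1) (x$2) l"
    unfolding disc_mass_def orbit_mass_def
  proof (intro nn_integral_cong)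
    fix a b :: real
    have "(\<integral>\<^sup>+t. ennreal (F (vector [a, b, t])) * indicator (cell x l) (vector [a, b, t]) \<partial>lborel) =
        (\<integral>\<^sup>+t. ennreal (F (vector [a, b, t])) * indicator {0..<2*pi} t *
          indicator {z. z < l\<^sup>2} ((x$1 - a)\<^sup>2 + (x$2 - b)\<^sup>2) \<partial>lborel)"
    proof (intro nn_integral_cong)
      fix t :: real
      have "sqrt ((x$1 - a)\<^sup>2 + (x$2 - b)\<^sup>2) < l \<longleftrightarrow> (x$1 - a)\<^sup>2 + (x$2 - b)\<^sup>2 < l\<^sup>2"
        using l real_sqrt_less_iff[of "(x$1 - a)\<^sup>2 + (x$2 - b)\<^sup>2" "l\<^sup>2"] by simp
      then show "ennreal (F (vector [a, b, t])) * indicator (cell x l) (vector [a, b, t]) =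
          ennreal (F (vector [a, b, t])) * indicator {0..<2*pi} t *
          indicator {z. z < l\<^sup>2} ((x$1 - a)\<^sup>2 + (x$2 - b)\<^sup>2)"
        by (auto simp: indicator_def cylinder_def)
    qed
    also have "\<dots> = (\<integral>\<^sup>+t\<in>{0..<2*pi}. ennreal (F (vector [a, b, t])) \<partial>lborel) *
          indicator {z. z < l\<^sup>2} ((x$1 - a)\<^sup>2 + (x$2 - b)\<^sup>2)"
      by (intro nn_integral_multc borel_measurable_times_ennreal Mt) measurable
    finally show "(\<integral>\<^sup>+t. ennreal (F (vector [a, b, t])) * indicator (cell x l) (vector [a, b, t]) \<partial>lborel) =
        (\<integral>\<^sup>+t\<in>{0..<2*pi}. (case (a, b, t) of (a, b, t) \<Rightarrow> ennreal (F (vector [a, b, t]))) \<partial>lborel) *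
          indicator {z. z < l\<^sup>2} ((x$1 - a)\<^sup>2 + (x$2 - b)\<^sup>2)"
      by simp
  qed
  finally show ?thesis .
qed

lemma Lp_norm_power:
  fixes f :: "real^3 \<Rightarrow> 'b::real_normed_vector"
  assumes f: "continuous_on UNIV f" and n: "0 < n"
  shows "Lp_norm (real n) (cylinder x l) f ^ n = enn2real (\<integral>\<^sup>+y\<in>cell x l. ennreal (norm (f y) ^ n) \<partial>lborel)"
proof -
  have M: "(\<lambda>y. norm (f y) ^ n) \<in> borel_measurable borel"
    using f by (intro borel_measurable_continuous_onI continuous_intros)
  \<comment> \<open>At zeros of \<open>f\<close>, \<open>powr\<close> yields 0, which agrees with
    the natural power because \<open>n\<close> is positive.\<close>
  have "norm (f y) powr real n = norm (f y) ^ n" for y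
    using n by (cases "f y = 0") (simp_all add: powr_realpow)
  then have "(LINT y:cell x l|lborel. norm (f y) powr real n) = (LINT y:cell x l|lborel. norm (f y) ^ n)"
    by simp
  \<comment> \<open>Valid even for a divergent integral: the Bochner integral and
    \<open>enn2real\<close> both return 0.\<close>
  also have "\<dots> = enn2real (\<integral>\<^sup>+y. ennreal (indicator (cell x l) y *\<^sub>R norm (f y) ^ n) \<partial>lborel)"
    unfolding set_lebesgue_integral_def using M by (intro integral_eq_nn_integral) auto
  also have "(\<integral>\<^sup>+y. ennreal (indicator (cell x l) y *\<^sub>R norm (f y) ^ n) \<partial>lborel) =
      (\<integral>\<^sup>+y\<in>cell x l. ennreal (norm (f y) ^ n) \<partial>lborel)"
    by (intro nn_integral_cong) (auto simp: indicator_def)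
  finally have I: "(LINT y:cell x l|lborel. norm (f y) powr real n) =
      enn2real (\<integral>\<^sup>+y\<in>cell x l. ennreal (norm (f y) ^ n) \<partial>lborel)" .
  have "(X powr (1 / real n)) ^ n = X" if "0 \<le> X" for X :: real
    using n that by (cases "X = 0") (simp_all add: powr_powr flip: powr_realpow)
  then show ?thesis
    unfolding Lp_norm_def I by simp
qed

section \<open>Ladyzhenskaya inequality for helical fields\<close>

theorem lemma5p4:
  shows "\<exists>C::real. C > 0 \<and>
    (\<forall>u :: real^3 \<Rightarrow> real^3. smooth u \<and> x3_periodic u \<and> helical u \<longrightarrow>
      (\<forall>x :: real^3.
        (Lp_norm 4 (cylinder x 1) u) ^ 4 \<le>
          C * ((Lp_norm 2 (cylinder x 2) u)\<^sup>2 * (Lp_norm 2 (cylinder x 2) (grad u))\<^sup>2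
               + (Lp_norm 2 (cylinder x 2) u) ^ 4)))"
proof (intro exI[of _ 72] conjI allI impI)
  fix u :: "real^3 \<Rightarrow> real^3" and x :: "real^3"
  assume "smooth u \<and> x3_periodic u \<and> helical u"
  then have u: "smooth u" "helical u" by auto
  have cu: "continuous_on UNIV u" and cg: "continuous_on UNIV (grad u)"
    using u by (auto intro: continuous_on_smooth continuous_on_grad)
  then have cu2: "continuous_on UNIV (\<lambda>y. norm (u y) ^ 2)" and cu4: "continuous_on UNIV (\<lambda>y. norm (u y) ^ 4)"
    and cg2: "continuous_on UNIV (\<lambda>y. norm (grad u y) ^ 2)"
    and cug: "continuous_on UNIV (\<lambda>y. norm (u y) * norm (grad u y))"
    by (auto intro!: continuous_intros)
  note ce = continuous_on_energy_density[OF u(1)]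
  have [measurable]: "u \<in> borel_measurable borel" "grad u \<in> borel_measurable borel"
    using cu cg by (auto intro: borel_measurable_continuous_onI)
  let ?g = "\<lambda>(a, b, t). ennreal ((norm (u (vector [a, b, t])))\<^sup>2)"
  let ?k = "\<lambda>(a, b, t). ennreal (energy_density u (vector [a, b, t]))"
  let ?g4 = "\<lambda>(a, b, t). ennreal (norm (u (vector [a, b, t])) ^ 4)"
  define A where "A = (\<integral>\<^sup>+y\<in>cell x 2. ennreal (norm (u y) ^ 2) \<partial>lborel)"
  define B where "B = (\<integral>\<^sup>+y\<in>cell x 2. ennreal (norm (grad u y) ^ 2) \<partial>lborel)"
  define X where "X = (\<integral>\<^sup>+y\<in>cell x 2. ennreal (norm (u y) * norm (grad u y)) \<partial>lborel)"
  define L where "L = (\<integral>\<^sup>+y\<in>cell x 1. ennreal (norm (u y) ^ 4) \<partial>lborel)"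
  interpret helical_sobolev_pair ?g ?k
    by (rule helical_sobolev_pair_of_field[OF u])
  \<comment> \<open>The fourth power is invariant as well, so its cylinder can also be rotated to
    the centre \<open>(?r, 0)\<close>.\<close>
  interpret g4: helical_density ?g4
    using u by (intro helical_density_of_screw cu4) (simp add: norm_screw)
  let ?r = "sqrt ((x$1)\<^sup>2 + (x$2)\<^sup>2)"
  have g4: "?g4 = (\<lambda>p. (?g p)\<^sup>2)"
    by (auto simp: ennreal_power simp flip: power_mult)
  have "L = disc_mass ?g4 ?r 0 1"
    unfolding L_def by (subst nn_integral_cell[OF cu4]) (simp_all add: g4.disc_mass_radial[of "x$1"])
  also have "\<dots> \<le> 9 * (disc_mass ?k ?r 0 2)\<^sup>2"
    unfolding g4 by (rule disc_mass_square_le) simp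
  also have "disc_mass ?k ?r 0 2 = (\<integral>\<^sup>+y\<in>cell x 2. ennreal (energy_density u y) \<partial>lborel)"
    by (subst nn_integral_cell[OF ce]) (simp_all add: k.disc_mass_radial[of "x$1"])
  also have "\<dots> = (\<integral>\<^sup>+y. ennreal (norm (u y) ^ 2) * indicator (cell x 2) y +
      2 * (ennreal (norm (u y) * norm (grad u y)) * indicator (cell x 2) y) \<partial>lborel)"
    by (intro nn_integral_cong)
       (auto simp: energy_density_def indicator_def ennreal_plus ennreal_mult' mult.assoc)
  also have "\<dots> = A + 2 * X"
    unfolding A_def X_def
    by (subst nn_integral_add) (simp_all add: nn_integral_cmult)
  finally have L: "L \<le> 9 * (A + 2 * X)\<^sup>2" .
  \<comment> \<open>The indicator is idempotent; one copy goes to each factor, ready for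
    Cauchy-Schwarz.\<close>
  have X_eq: "X = (\<integral>\<^sup>+y. (ennreal (norm (u y)) * indicator (cell x 2) y) *
      (ennreal (norm (grad u y)) * indicator (cell x 2) y) \<partial>lborel)"
    unfolding X_def by (intro nn_integral_cong) (auto simp: indicator_def ennreal_mult)
  have "(\<integral>\<^sup>+y. (ennreal (norm (u y)) * indicator (cell x 2) y)\<^sup>2 \<partial>lborel) = A"
    unfolding A_def by (intro nn_integral_cong) (auto simp: indicator_def ennreal_power)
  moreover have "(\<integral>\<^sup>+y. (ennreal (norm (grad u y)) * indicator (cell x 2) y)\<^sup>2 \<partial>lborel) = B"
    unfolding B_def by (intro nn_integral_cong) (auto simp: indicator_def ennreal_power)
  moreover have "X\<^sup>2 \<le> (\<integral>\<^sup>+y. (ennreal (norm (u y)) * indicator (cell x 2) y)\<^sup>2 \<partial>lborel) *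
      (\<integral>\<^sup>+y. (ennreal (norm (grad u y)) * indicator (cell x 2) y)\<^sup>2 \<partial>lborel)"
    unfolding X_eq by (rule Cauchy_Schwarz_nn_integral) measurable
  ultimately have X: "X\<^sup>2 \<le> A * B"
    by (simp only:)
  have "A < \<infinity>" "B < \<infinity>" "X < \<infinity>" "L < \<infinity>"
    unfolding A_def B_def X_def L_def
    by (rule nn_integral_cell_finite cu2 cg2 cug cu4)+
  then obtain A' B' X' L' where R: "A = ennreal A'" "B = ennreal B'" "X = ennreal X'" "L = ennreal L'"
      and nonneg: "0 \<le> A'" "0 \<le> B'" "0 \<le> X'" "0 \<le> L'"
    by (cases A; cases B; cases X; cases L) auto
  have "A + 2 * X = ennreal (A' + 2 * X')"
    using nonneg by (simp add: R ennreal_mult)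
  then have "9 * (A + 2 * X)\<^sup>2 = ennreal (9 * (A' + 2 * X')\<^sup>2)"
    using nonneg by (simp add: ennreal_power ennreal_mult del: ennreal_plus)
  then have "ennreal L' \<le> ennreal (9 * (A' + 2 * X')\<^sup>2)"
    using L by (simp only: R)
  then have "L' \<le> 9 * (A' + 2 * X')\<^sup>2"
    by (simp add: ennreal_le_iff)
  \<comment> \<open>From \<open>(A' - 2 * X')^2 \<ge> 0\<close>. The coefficient
    \<open>9 * 8 = 72\<close> of \<open>X'^2\<close> becomes the constant of the theorem once
    \<open>X'^2 \<le> A' * B'\<close> is inserted; that of \<open>A'^2\<close> is only 18.\<close>
  also have "\<dots> \<le> 9 * (2 * A'\<^sup>2 + 8 * X'\<^sup>2)"
    using zero_le_power2[of "A' - 2 * X'"] by (simp add: power2_eq_square algebra_simps)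
  also have "X'\<^sup>2 \<le> A' * B'"
    using X nonneg by (simp add: R ennreal_power flip: ennreal_mult)
  also have "9 * (2 * A'\<^sup>2 + 8 * (A' * B')) \<le> 72 * (A' * B' + A'\<^sup>2)"
    by simp
  finally have main: "L' \<le> 72 * (A' * B' + A'\<^sup>2)"
    by simp
  have L4: "Lp_norm 4 (cylinder x 1) u ^ 4 = L'"
    using Lp_norm_power[OF cu, of 4 x 1] nonneg by (simp add: R flip: L_def)
  have A2: "(Lp_norm 2 (cylinder x 2) u)\<^sup>2 = A'"
    using Lp_norm_power[OF cu, of 2 x 2] nonneg by (simp add: R flip: A_def)
  have B2: "(Lp_norm 2 (cylinder x 2) (grad u))\<^sup>2 = B'"
    using Lp_norm_power[OF cg, of 2 x 2] nonneg by (simp add: R flip: B_def)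
  have A4: "Lp_norm 2 (cylinder x 2) u ^ 4 = A'\<^sup>2"
    unfolding A2[symmetric] by (simp flip: power_mult)
  show "(Lp_norm 4 (cylinder x 1) u) ^ 4 \<le>
      72 * ((Lp_norm 2 (cylinder x 2) u)\<^sup>2 * (Lp_norm 2 (cylinder x 2) (grad u))\<^sup>2
        + (Lp_norm 2 (cylinder x 2) u) ^ 4)"
    unfolding L4 A4 A2 B2 by (rule main)
qed simp

end
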